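(* Let $\mathcal{M}$ be a class of set-systems. Then $\mathcal{M}$ is automatic if and only if it has bounded decomposition-width.
   Context: Set-systems and decomposition-width. A set-system is a pair $(E,\mathcal{I})$ where $E$ is a finite non-empty set and $\mathcal{I}$ is a family of subsets of $E$. For $U\subseteq E$ and $X,X'\subseteq U$, write $X\sim_U X'$ if for every $Z\subseteq E-U$, $X\cup Z\in\mathcal{I}$ if and only if $X'\cup Z\in\mathcal{I}$. A subcubic tree is a tree in which every vertex has degree three or one (the one-vertex tree is also allowed, its vertex counting as a leaf); degree-one vertices are leaves. A decomposition of $M=(E,\mathcal{I})$ is a pair $(T,\varphi)$ with $T$ a subcubic tree and $\varphi$ a bijection from $E$ to the leaves of $T$. An edge $e=uv$ of $T$ displays the sets $U_e$ and $V_e=E-U_e$, where $x\in U_e$ if and only if the path in $T$ from $\varphi(x)$ to $u$ does not contain $v$. Then $\operatorname{dw}(M;T,\varphi)$ is the maximum number of equivalence classes of $\sim_U$ over all sets $U$ displayed by edges of $T$ ($0$ if there are no edges), and the decomposition-width $\operatorname{dw}(M)$ is the minimum of $\operatorname{dw}(M;T,\varphi)$ over all decompositions. A class $\mathcal{M}$ has bounded decomposition-width if there is an integer $K$ with $\operatorname{dw}(M)\le K$ for all $M\in\mathcal{M}$. Trees. Rooted trees $T$ have a distinguished root $t$; every vertex other than $t$ has degree one or three, and if $T$ has more than one vertex then $t$ has degree two. The leaves are the degree-one vertices (and $t$, if $t$ is the only vertex); $L(T)$ is the set of leaves. A non-leaf $v$ is adjacent to two vertices not on the path from $v$ to $t$,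 its children, distinguished as left child and right child. For a finite alphabet $\Sigma$, a $\Sigma$-tree is a pair $(T,\sigma)$ with $\sigma\colon V(T)\to\Sigma$. Automata. A tree automaton is a tuple $A=(\Sigma,Q,F,\delta_0,\delta_2)$ with $\Sigma$ a finite alphabet, $Q$ a finite set of states, $F\subseteq Q$ the accepting states, $\delta_0$ a partial function from $\Sigma$ to $2^Q$, and $\delta_2$ a partial function from $\Sigma\times Q\times Q$ to $2^Q$. The run of $A$ on a $\Sigma$-tree $(T,\sigma)$ is $r\colon V(T)\to 2^Q$ where: if $v$ is a leaf, $r(v)=\delta_0(\sigma(v))$ if defined and $\emptyset$ otherwise; if $v$ has left child $v_L$ and right child $v_R$, then $r(v)=\bigcup_{(q_L,q_R)\in r(v_L)\times r(v_R)}\delta_2(\sigma(v),q_L,q_R)$ if all these images are defined, and $\emptyset$ otherwise (an empty union is $\emptyset$). $A$ accepts $(T,\sigma)$ if $r(t)\cap F\ne\emptyset$. Encoding sets. Let $i$ be a positive integer. An $\{i\}$-ary tree automaton with alphabet $\Sigma$ is a tree automaton whose actual alphabet is $\Sigma\cup(\Sigma\times\{0,1\}^{\{i\}})$ and whose $\delta_0$ is defined only on elements of $\Sigma\times\{0,1\}^{\{i\}}$. Given a $\Sigma$-tree $(T,\sigma)$, a bijection $\varphi\colon E\to L(T)$ and $Y\subseteq E$, $\operatorname{enc}(T,\sigma,\varphi,\{Y\})$ is the tree $T$ in which each non-leaf $v$ has label $\sigma(v)$, and each leaf $v$ has label $(\sigma(v),s)$ with $s(i)=1$ if $\varphi^{-1}(v)\in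 Y$ and $s(i)=0$ otherwise. For an $\{i\}$-ary automaton $A$ with alphabet $\Sigma$, let $M(A,T,\sigma,\varphi)=(E,\{Y\subseteq E: A\text{ accepts }\operatorname{enc}(T,\sigma,\varphi,\{Y\})\})$. Automatic. A class $\mathcal{M}$ of set-systems is automatic if there is an $\{i\}$-ary tree automaton $A$ with some finite alphabet $\Sigma$ such that for every $M=(E,\mathcal{I})\in\mathcal{M}$ there is a $\Sigma$-tree $(T_M,\sigma_M)$ and a bijection $\varphi_M\colon E\to L(T_M)$ with $M=M(A,T_M,\sigma_M,\varphi_M)$. *)

theory Defs
  imports "Graph_Theory.Graph_Theory" "HOL-Library.FuncSet"
begin

section \<open>Set-systems and decomposition-width\<close>

type_synonym 'a set_system = "'a set \<times> 'a set set"

definition set_system :: "'a set_system \<Rightarrow> bool" where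
  "set_system M \<longleftrightarrow> finite (fst M) \<and> fst M \<noteq> {} \<and> snd M \<subseteq> Pow (fst M)"

definition set_equiv :: "'a set_system \<Rightarrow> 'a set \<Rightarrow> 'a set rel" where
  "set_equiv M U = {(X, X'). X \<subseteq> U \<and> X' \<subseteq> U \<and>
     (\<forall>Z. Z \<subseteq> fst M - U \<longrightarrow> (X \<union> Z \<in> snd M \<longleftrightarrow> X' \<union> Z \<in> snd M))}"

text \<open>
  Undirected finite simple graphs are symmetric loop-free digraphs (\<^locale>\<open>pair_graph\<close>).
  The library's \<^const>\<open>tree\<close> cannot be used: it speaks about directed cycles, so it
  counts the back-and-forth walk along an undirected edge as a cycle. Here a cycle is
  a path on at least three vertices whose ends are adjacent.
\<close>

definition undirected_tree :: "'v pair_pre_digraph \<Rightarrow> bool" where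
  "undirected_tree T \<longleftrightarrow> pair_graph T \<and> Digraph_Component.connected (with_proj T) \<and>
     \<not> (\<exists>p. vpath p (with_proj T) \<and> 3 \<le> length p \<and> (last p, hd p) \<in> parcs T)"

abbreviation degree :: "'v pair_pre_digraph \<Rightarrow> 'v \<Rightarrow> nat" where
  "degree T v \<equiv> out_degree (with_proj T) v"

definition subcubic_tree :: "'v pair_pre_digraph \<Rightarrow> bool" where
  "subcubic_tree T \<longleftrightarrow> undirected_tree T \<and>
     (card (pverts T) = 1 \<or> (\<forall>v \<in> pverts T. degree T v = 3 \<or> degree T v = 1))"

definition subcubic_leaves :: "'v pair_pre_digraph \<Rightarrow> 'v set" where
  "subcubic_leaves T = {v \<in> pverts T. degree T v = 1 \<or> pverts T = {v}}"

definition decomposition ::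
    "'a set_system \<Rightarrow> 'v pair_pre_digraph \<Rightarrow> ('a \<Rightarrow> 'v) \<Rightarrow> bool" where
  "decomposition M T \<phi> \<longleftrightarrow> subcubic_tree T \<and> bij_betw \<phi> (fst M) (subcubic_leaves T)"

text \<open>The set \<open>U\<^sub>e\<close> for the edge \<open>e = uv\<close>; paths in a tree are unique.\<close>

definition edge_side ::
    "'a set_system \<Rightarrow> 'v pair_pre_digraph \<Rightarrow> ('a \<Rightarrow> 'v) \<Rightarrow> 'v \<Rightarrow> 'v \<Rightarrow> 'a set" where
  "edge_side M T \<phi> u v =
     {x \<in> fst M. \<exists>p. vpath p (with_proj T) \<and> hd p = \<phi> x \<and> last p = u \<and> v \<notin> set p}"

definition displayed_sets ::
    "'a set_system \<Rightarrow> 'v pair_pre_digraph \<Rightarrow> ('a \<Rightarrow> 'v) \<Rightarrow> 'a set set" where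
  "displayed_sets M T \<phi> =
     (\<Union>(u, v) \<in> parcs T. {edge_side M T \<phi> u v, fst M - edge_side M T \<phi> u v})"

definition decomposition_dw ::
    "'a set_system \<Rightarrow> 'v pair_pre_digraph \<Rightarrow> ('a \<Rightarrow> 'v) \<Rightarrow> nat" where
  "decomposition_dw M T \<phi> =
     Max (insert 0 ((\<lambda>U. card (Pow U // set_equiv M U)) ` displayed_sets M T \<phi>))"

text \<open>Every finite tree is isomorphic to one whose vertices are natural numbers.\<close>

definition decomposition_width :: "'a set_system \<Rightarrow> nat" where
  "decomposition_width M =
     (LEAST k. \<exists>(T :: nat pair_pre_digraph) \<phi>. decomposition M T \<phi> \<and> k = decomposition_dw M T \<phi>)"

definition bounded_decomposition_width :: "'a set_system set \<Rightarrow> bool" where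
  "bounded_decomposition_width \<M> \<longleftrightarrow> (\<exists>K. \<forall>M \<in> \<M>. decomposition_width M \<le> K)"


section \<open>Rooted trees and tree automata\<close>

text \<open>
  A rooted tree in which every non-leaf has a left and a right child is an element of
  the following datatype. Its vertices are the positions, i.e. the sequences of
  directions leading from the root, which is the empty sequence.
\<close>

datatype rooted_tree = Leaf | Node rooted_tree rooted_tree

datatype direction = Lft | Rgt

type_synonym position = "direction list"

primrec vertices :: "rooted_tree \<Rightarrow> position set" where
  "vertices Leaf = {[]}"
| "vertices (Node l r) = insert [] (Cons Lft ` vertices l \<union> Cons Rgt ` vertices r)"

primrec leaves :: "rooted_tree \<Rightarrow> position set" where
  "leaves Leaf = {[]}"
| "leaves (Node l r) = Cons Lft ` leaves l \<union> Cons Rgt ` leaves r"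

definition sigma_tree :: "'s set \<Rightarrow> rooted_tree \<Rightarrow> (position \<Rightarrow> 's) \<Rightarrow> bool" where
  "sigma_tree \<Sigma> T \<sigma> \<longleftrightarrow> (\<forall>v \<in> vertices T. \<sigma> v \<in> \<Sigma>)"

record ('s, 'q) automaton =
  alphabet :: "'s set"
  states :: "'q set"
  accepting :: "'q set"
  delta0 :: "'s \<rightharpoonup> 'q set"
  delta2 :: "'s \<times> 'q \<times> 'q \<rightharpoonup> 'q set"

definition tree_automaton :: "('s, 'q) automaton \<Rightarrow> bool" where
  "tree_automaton A \<longleftrightarrow>
     finite (alphabet A) \<and> finite (states A) \<and> accepting A \<subseteq> states A \<and>
     dom (delta0 A) \<subseteq> alphabet A \<and> ran (delta0 A) \<subseteq> Pow (states A) \<and>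
     dom (delta2 A) \<subseteq> alphabet A \<times> states A \<times> states A \<and> ran (delta2 A) \<subseteq> Pow (states A)"

definition leaf_step :: "('s, 'q) automaton \<Rightarrow> 's \<Rightarrow> 'q set" where
  "leaf_step A s = (case delta0 A s of None \<Rightarrow> {} | Some R \<Rightarrow> R)"

definition node_step :: "('s, 'q) automaton \<Rightarrow> 's \<Rightarrow> 'q set \<Rightarrow> 'q set \<Rightarrow> 'q set" where
  "node_step A s RL RR =
     (if \<forall>(qL, qR) \<in> RL \<times> RR. delta2 A (s, qL, qR) \<noteq> None
      then \<Union>(qL, qR) \<in> RL \<times> RR. the (delta2 A (s, qL, qR))
      else {})"

text \<open>
  The value at a vertex depends only on the subtree below it; the positions of the left
  subtree are those of the whole tree with the leading \<^const>\<open>Lft\<close> removed, and dually.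
\<close>

primrec run :: "('s, 'q) automaton \<Rightarrow> rooted_tree \<Rightarrow> (position \<Rightarrow> 's) \<Rightarrow> position \<Rightarrow> 'q set" where
  "run A Leaf = (\<lambda>\<sigma> v. leaf_step A (\<sigma> v))"
| "run A (Node l r) = (\<lambda>\<sigma> v. case v of
      [] \<Rightarrow> node_step A (\<sigma> [])
              (run A l (\<lambda>w. \<sigma> (Lft # w)) []) (run A r (\<lambda>w. \<sigma> (Rgt # w)) [])
    | d # w \<Rightarrow> (case d of
          Lft \<Rightarrow> run A l (\<lambda>w. \<sigma> (Lft # w)) w
        | Rgt \<Rightarrow> run A r (\<lambda>w. \<sigma> (Rgt # w)) w))"

definition accepts :: "('s, 'q) automaton \<Rightarrow> rooted_tree \<Rightarrow> (position \<Rightarrow> 's) \<Rightarrow> bool" where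
  "accepts A T \<sigma> \<longleftrightarrow> run A T \<sigma> [] \<inter> accepting A \<noteq> {}"


section \<open>Automatic classes\<close>

text \<open>
  The alphabet \<open>\<Sigma> \<union> (\<Sigma> \<times> {0,1}\<^sup>{\<^sup>i\<^sup>})\<close> of an \<open>{i}\<close>-ary automaton is rendered as a
  disjoint sum; the second summand consists of pairs of a letter and a function from
  \<open>{i}\<close> to \<open>{0,1}\<close>.
\<close>

type_synonym 's enc_letter = "'s + 's \<times> (nat \<Rightarrow> nat)"

definition ary_automaton :: "nat \<Rightarrow> 's set \<Rightarrow> ('s enc_letter, 'q) automaton \<Rightarrow> bool" where
  "ary_automaton i \<Sigma> A \<longleftrightarrow> finite \<Sigma> \<and> tree_automaton A \<and>
     alphabet A = \<Sigma> <+> \<Sigma> \<times> ({i} \<rightarrow>\<^sub>E {0, 1}) \<and>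
     dom (delta0 A) \<subseteq> Inr ` (\<Sigma> \<times> ({i} \<rightarrow>\<^sub>E {0, 1}))"

definition enc :: "nat \<Rightarrow> 'a set \<Rightarrow> rooted_tree \<Rightarrow> (position \<Rightarrow> 's) \<Rightarrow> ('a \<Rightarrow> position) \<Rightarrow> 'a set
    \<Rightarrow> position \<Rightarrow> 's enc_letter" where
  "enc i E T \<sigma> \<phi> Y v =
     (if v \<in> leaves T
      then Inr (\<sigma> v, \<lambda>j\<in>{i}. if inv_into E \<phi> v \<in> Y then 1 else 0)
      else Inl (\<sigma> v))"

definition encoded_set_system :: "nat \<Rightarrow> ('s enc_letter, 'q) automaton \<Rightarrow> 'a set
    \<Rightarrow> rooted_tree \<Rightarrow> (position \<Rightarrow> 's) \<Rightarrow> ('a \<Rightarrow> position) \<Rightarrow> 'a set_system" where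
  "encoded_set_system i A E T \<sigma> \<phi> = (E, {Y. Y \<subseteq> E \<and> accepts A T (enc i E T \<sigma> \<phi> Y)})"

text \<open>Finite alphabets and state sets are taken, up to renaming, to be sets of natural numbers.\<close>

definition automatic :: "'a set_system set \<Rightarrow> bool" where
  "automatic \<M> \<longleftrightarrow>
     (\<exists>(i :: nat) (\<Sigma> :: nat set) (A :: (nat enc_letter, nat) automaton).
        0 < i \<and> ary_automaton i \<Sigma> A \<and>
        (\<forall>M \<in> \<M>. \<exists>T \<sigma> \<phi>. sigma_tree \<Sigma> T \<sigma> \<and> bij_betw \<phi> (fst M) (leaves T) \<and>
           M = encoded_set_system i A (fst M) T \<sigma> \<phi>))"

end

theory Submission
  imports Defs
begin

text \<open>
  If an automaton with \<open>n\<close> states encodes a set-system on a rooted tree, then the class of a set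
  below a vertex is determined by the value of the run there, so there are at most \<open>2\<^sup>n\<close> classes;
  the classes on the other side of the edge are determined by how they combine with these, which
  gives \<open>2\<close> to the power \<open>2\<^sup>n\<close>. Suppressing the root turns the rooted tree into a subcubic one.
  Conversely, subdivide an edge of a decomposition of width at most \<open>K\<close> to obtain a root, and
  number the classes at each edge by \<open>0, \<dots>, K - 1\<close>. Equivalence is a congruence for disjoint
  unions, so each vertex can be labelled by the table that computes its class number from
  those of its children, and a single automaton evaluates all these tables.
\<close>

section \<open>Sides of edges in undirected trees\<close>

text \<open>Decompositions are unrooted graphs whose sides are defined by paths, while automata run
  on a datatype whose vertices are direction sequences. No general isomorphism between the two kinds
  of tree is set up. Coming from a graph, only displayed sets matter: it suffices that the ground
  set arises from singletons by disjoint unions that stay among displayed sets, and induction over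
  such a construction yields the datatype tree. Going to a graph, positions become heap numbers, so
  that the sides of an edge are described by repeated halving. A run value is a set of states, hence
  \<open>2^n\<close> rather than \<open>n\<close>; the second exponential pays for the side of an
  edge that contains the root, about which the run below the edge says nothing directly.\<close>

definition avoiding :: "'v pair_pre_digraph \<Rightarrow> 'v \<Rightarrow> 'v rel" where
  "avoiding T v = parcs T \<inter> (- {v}) \<times> (- {v})"

text \<open>The vertex-level counterpart of \<open>edge_side\<close>, free of the set-system and of
  \<phi>. Reachability after deleting \<open>v\<close> replaces paths, because a reflexive
  transitive closure supports induction along single arcs.\<close>

definition side :: "'v pair_pre_digraph \<Rightarrow> 'v \<Rightarrow> 'v \<Rightarrow> 'v set" where
  "side T u v = {w \<in> pverts T - {v}. (w, u) \<in> (avoiding T v)\<^sup>*}"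

lemma vwalk_avoiding:
  assumes "vwalk p (with_proj T)" "v \<notin> set p"
  shows "(hd p, last p) \<in> (avoiding T v)\<^sup>*"
  using assms
proof (induction p rule: vwalk_arcs.induct)
  case (3 x y xs)
  then have "(x, y) \<in> avoiding T v" "vwalk (y # xs) (with_proj T)"
    by (auto simp: avoiding_def vwalk_def)
  with 3 show ?case
    by (auto intro: converse_rtrancl_into_rtrancl)
qed (auto simp: vwalk_def)

lemma avoiding_vwalk:
  assumes wf: "parcs T \<subseteq> pverts T \<times> pverts T" and b: "b \<in> pverts T - {v}"
    and "(a, b) \<in> (avoiding T v)\<^sup>*"
  shows "\<exists>p. vwalk p (with_proj T) \<and> hd p = a \<and> last p = b \<and> v \<notin> set p"
  using assms(3)
proof (induction rule: converse_rtrancl_induct)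
  case base
  have "vwalk [b] (with_proj T)"
    using b by (auto simp: vwalk_def)
  then show ?case
    using b by (intro exI[of _ "[b]"]) auto
next
  case (step y z)
  then obtain p where p: "vwalk p (with_proj T)" "hd p = z" "last p = b" "v \<notin> set p"
    by blast
  then obtain q where q: "p = z # q"
    by (cases p) (auto simp: vwalk_def)
  have "vwalk (y # p) (with_proj T)" "y \<noteq> v"
    using p step.hyps(1) wf unfolding q by (auto simp: vwalk_def avoiding_def)
  then show ?case
    using p q by (intro exI[of _ "y # p"]) auto
qed

text \<open>A walk becomes a path by cutting out its loops; this adds no vertex, so \<open>v\<close>
  is still missed. It allows all later arguments to forget about distinctness.\<close>

lemma vpath_avoiding_iff:
  assumes wf: "parcs T \<subseteq> pverts T \<times> pverts T" and b: "b \<in> pverts T - {v}"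
  shows "(\<exists>p. vpath p (with_proj T) \<and> hd p = a \<and> last p = b \<and> v \<notin> set p) \<longleftrightarrow>
    a \<in> pverts T - {v} \<and> (a, b) \<in> (avoiding T v)\<^sup>*"
proof
  assume "\<exists>p. vpath p (with_proj T) \<and> hd p = a \<and> last p = b \<and> v \<notin> set p"
  then obtain p where p: "vpath p (with_proj T)" "hd p = a" "last p = b" "v \<notin> set p"
    by blast
  then have "vwalk p (with_proj T)" and "a \<in> set p"
    by (auto simp: vpath_def vwalk_def)
  with p show "a \<in> pverts T - {v} \<and> (a, b) \<in> (avoiding T v)\<^sup>*"
    using vwalk_avoiding[of p T v] by (auto simp: vwalk_def)
next
  assume "a \<in> pverts T - {v} \<and> (a, b) \<in> (avoiding T v)\<^sup>*"
  then obtain p where p: "vwalk p (with_proj T)" "hd p = a" "last p = b" "v \<notin> set p"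
    using avoiding_vwalk[OF assms] by blast
  then show "\<exists>p. vpath p (with_proj T) \<and> hd p = a \<and> last p = b \<and> v \<notin> set p"
    by (intro exI[of _ "vwalk_to_vpath p"])
      (auto simp: vwalk_to_vpath_hd vwalk_to_vpath_last vwalk_to_vpath_vpath
        dest: vwalk_to_vpath_subset)
qed

section \<open>Undirected trees as symmetric relations\<close>

lemma pair_graphD:
  assumes "pair_graph T"
  shows "parcs T \<subseteq> pverts T \<times> pverts T" "finite (pverts T)" "finite (parcs T)"
    "sym (parcs T)" "(v, v) \<notin> parcs T"
proof -
  interpret pair_graph T by fact
  show "parcs T \<subseteq> pverts T \<times> pverts T"
    using arc_fst_in_verts arc_snd_in_verts by force
  show "finite (pverts T)" "finite (parcs T)"
    by (rule pair_finite_verts, rule pair_finite_arcs)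
  show "sym (parcs T)"
    using pair_sym_arcs by (simp add: symmetric_def)
  show "(v, v) \<notin> parcs T"
    using pair_no_loops[of "(v, v)"] by auto
qed

lemma pair_graphI:
  assumes "parcs T \<subseteq> pverts T \<times> pverts T" "finite (pverts T)" "sym (parcs T)"
    "\<And>v. (v, v) \<notin> parcs T"
  shows "pair_graph T"
proof -
  have "finite (parcs T)"
    using assms(1,2) finite_subset by blast
  then show ?thesis
    by unfold_locales (use assms in \<open>auto simp: symmetric_def\<close>)
qed

text \<open>Connectedness is stated through the symmetric closure and \<open>rtrancl_on\<close>. The
  arc relation is already symmetric and stays within the vertices, so both collapse to the ordinary
  closure.\<close>

lemma connected_iff_rtrancl:
  assumes "pair_graph T"
  shows "Digraph_Component.connected (with_proj T) \<longleftrightarrow>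
    pverts T \<noteq> {} \<and> (\<forall>u \<in> pverts T. \<forall>v \<in> pverts T. (u, v) \<in> (parcs T)\<^sup>*)"
proof -
  note T = pair_graphD[OF assms]
  have sc: "symcl (parcs T) = parcs T"
    using T(4) by (auto simp: symcl_def sym_def)
  have "(u, v) \<in> rtrancl_on (pverts T) (parcs T)"
    if "(u, v) \<in> (parcs T)\<^sup>*" "v \<in> pverts T" for u v
    using that
  proof (induction rule: converse_rtrancl_induct)
    case (step y z)
    then show ?case
      using T(1) by (auto intro: converse_rtrancl_on_into_rtrancl_on)
  qed auto
  moreover have "(u, v) \<in> (parcs T)\<^sup>*" if "(u, v) \<in> rtrancl_on (pverts T) (parcs T)" for u v
    using that by (rule rtrancl_on_rtranclI)
  ultimately show ?thesis
    unfolding connected_conv with_proj_simps sc by blast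
qed

lemma edge_side_eq:
  assumes "pair_graph T" "(u, v) \<in> parcs T"
  shows "edge_side M T \<phi> u v = {x \<in> fst M. \<phi> x \<in> side T u v}"
proof -
  note T = pair_graphD[OF assms(1)]
  have "u \<in> pverts T - {v}"
    using T(1,5) assms(2) by auto
  from vpath_avoiding_iff[OF T(1) this] show ?thesis
    unfolding edge_side_def side_def by simp
qed

locale undirected_tree_graph =
  fixes T :: "'v pair_pre_digraph"
  assumes tree: "undirected_tree T"
begin

lemma graph: "pair_graph T"
  using tree by (simp add: undirected_tree_def)

lemmas arcs_verts = pair_graphD(1)[OF graph]
lemmas finite_verts = pair_graphD(2)[OF graph]
lemmas no_loop = pair_graphD(5)[OF graph]

lemma arc_sym: "(u, v) \<in> parcs T \<Longrightarrow> (v, u) \<in> parcs T"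
  using pair_graphD(4)[OF graph] by (auto simp: sym_def)

lemma arc_neq: "(u, v) \<in> parcs T \<Longrightarrow> u \<noteq> v"
  using no_loop by auto

lemma rtrancl_arcs: "u \<in> pverts T \<Longrightarrow> v \<in> pverts T \<Longrightarrow> (u, v) \<in> (parcs T)\<^sup>*"
  using tree connected_iff_rtrancl[OF graph] by (auto simp: undirected_tree_def)

lemma sym_avoiding: "(a, b) \<in> (avoiding T v)\<^sup>* \<Longrightarrow> (b, a) \<in> (avoiding T v)\<^sup>*"
proof -
  have "sym (avoiding T v)"
    using arc_sym by (auto simp: avoiding_def sym_def)
  then show "(a, b) \<in> (avoiding T v)\<^sup>* \<Longrightarrow> (b, a) \<in> (avoiding T v)\<^sup>*"
    by (meson symD sym_rtrancl)
qed

text \<open>This is where acyclicity enters: a path from \<open>a\<close> to \<open>b\<close> that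
  avoids \<open>u\<close>, prefixed by \<open>u\<close>, has at least three vertices and adjacent
  ends.\<close>

lemma neighbours_separated:
  assumes "(a, u) \<in> parcs T" "(b, u) \<in> parcs T" "a \<noteq> b"
  shows "(a, b) \<notin> (avoiding T u)\<^sup>*"
proof
  assume "(a, b) \<in> (avoiding T u)\<^sup>*"
  moreover have "a \<in> pverts T - {u}" "b \<in> pverts T - {u}"
    using assms arcs_verts arc_neq by auto
  ultimately obtain p where p: "vpath p (with_proj T)" "hd p = a" "last p = b" "u \<notin> set p"
    using vpath_avoiding_iff[OF arcs_verts] by blast
  then obtain q where q: "p = a # q" "q \<noteq> []"
    using \<open>a \<noteq> b\<close> by (cases p) (auto simp: vpath_def vwalk_def split: if_splits)
  have "vpath (u # p) (with_proj T)"
    using p q arc_sym[OF assms(1)] arcs_verts by (auto simp: vpath_def vwalk_def)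
  moreover have "3 \<le> length (u # p)"
    using q by (cases q) auto
  moreover have "(last (u # p), hd (u # p)) \<in> parcs T"
    using p q assms by auto
  ultimately show False
    using tree unfolding undirected_tree_def by blast
qed

lemma self_in_side: "(u, v) \<in> parcs T \<Longrightarrow> u \<in> side T u v"
  using arcs_verts arc_neq by (auto simp: side_def)

lemma side_disjoint:
  assumes "(a, u) \<in> parcs T" "(b, u) \<in> parcs T" "a \<noteq> b"
  shows "side T a u \<inter> side T b u = {}"
  using neighbours_separated[OF assms] sym_avoiding
  by (auto simp: side_def) (meson rtrancl_trans)

text \<open>Follow the walk from \<open>w\<close> to \<open>u\<close> that misses \<open>v\<close>.
  A step not touching \<open>u\<close> stays in one branch at \<open>u\<close>, and a step into
  \<open>u\<close> starts at a neighbour other than \<open>v\<close>.\<close>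

lemma side_cases:
  assumes "w \<in> side T u v" "(u, v) \<in> parcs T"
  shows "w = u \<or> (\<exists>c. (c, u) \<in> parcs T \<and> c \<noteq> v \<and> w \<in> side T c u)"
proof -
  have "(w, u) \<in> (avoiding T v)\<^sup>*"
    using assms by (simp add: side_def)
  then show ?thesis
  proof (induction rule: converse_rtrancl_induct)
    case (step y z)
    then have yz: "(y, z) \<in> parcs T" "y \<noteq> v" "z \<noteq> v"
      by (auto simp: avoiding_def)
    show ?case
    proof (cases "y = u \<or> z = u")
      case True
      then show ?thesis
        using yz self_in_side by blast
    next
      case False
      then have "(y, z) \<in> avoiding T u" "y \<in> pverts T - {u}"
        using yz arcs_verts by (auto simp: avoiding_def)
      with step.IH False show ?thesis
        by (auto simp: side_def intro: converse_rtrancl_into_rtrancl)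
    qed
  qed simp
qed

text \<open>A walk to \<open>c\<close> avoiding \<open>u\<close> cannot meet \<open>v\<close>, since
  \<open>v\<close> and \<open>c\<close> are distinct neighbours of \<open>u\<close> and hence
  separated by it. Appending the arc from \<open>c\<close> to \<open>u\<close> gives a walk to
  \<open>u\<close> that avoids \<open>v\<close>.\<close>

lemma side_subset:
  assumes "(c, u) \<in> parcs T" "(u, v) \<in> parcs T" "c \<noteq> v"
  shows "side T c u \<subseteq> side T u v"
proof
  fix w
  assume w: "w \<in> side T c u"
  have vc: "(v, c) \<notin> (avoiding T u)\<^sup>*"
    using neighbours_separated assms arc_sym by blast
  have cu: "(c, u) \<in> avoiding T v"
    using assms arc_neq by (auto simp: avoiding_def)
  have "(w, c) \<in> (avoiding T u)\<^sup>*"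
    using w by (simp add: side_def)
  then have "(w, u) \<in> (avoiding T v)\<^sup>*"
  proof (induction rule: converse_rtrancl_induct)
    case base
    then show ?case
      using cu by blast
  next
    case (step y z)
    have "y \<noteq> v" "z \<noteq> v"
      using step.hyps vc by (auto dest: converse_rtrancl_into_rtrancl)
    then have "(y, z) \<in> avoiding T v"
      using step.hyps by (auto simp: avoiding_def)
    then show ?case
      using step.IH by (rule converse_rtrancl_into_rtrancl)
  qed
  moreover have "w \<noteq> v"
    using w vc by (auto simp: side_def)
  ultimately show "w \<in> side T u v"
    using w by (auto simp: side_def)
qed

text \<open>Connectedness gives the covering: along a walk to \<open>u\<close>, a step between
  vertices other than \<open>u\<close> and \<open>v\<close> does not change the side. For
  disjointness, a common vertex would lie in the branch of \<open>v\<close> at \<open>u\<close> and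
  also be \<open>u\<close> itself or lie in another branch there.\<close>

lemma side_complement:
  assumes "(u, v) \<in> parcs T"
  shows "side T v u = pverts T - side T u v"
proof -
  have "w \<in> side T u v \<union> side T v u" if "w \<in> pverts T" for w
  proof -
    have "(w, u) \<in> (parcs T)\<^sup>*"
      using that assms arcs_verts rtrancl_arcs by blast
    then show ?thesis
    proof (induction rule: converse_rtrancl_induct)
      case base
      then show ?case
        using self_in_side[OF assms] by blast
    next
      case (step y z)
      then have y: "y \<in> pverts T"
        using arcs_verts by blast
      consider "y = u" | "y = v" | "y \<noteq> u" "y \<noteq> v"
        by blast
      then show ?case
      proof cases
        case 3
        show ?thesis
        proof (cases "z \<in> side T u v")
          case True
          then have "(y, z) \<in> avoiding T v"
            using 3 step.hyps by (auto simp: avoiding_def side_def)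
          then show ?thesis
            using 3 y True by (auto simp: side_def intro: converse_rtrancl_into_rtrancl)
        next
          case False
          then have "z \<in> side T v u"
            using step.IH by blast
          then have "(y, z) \<in> avoiding T u" "z \<in> side T v u"
            using 3 step.hyps by (auto simp: avoiding_def side_def)
          then show ?thesis
            using 3 y by (auto simp: side_def intro: converse_rtrancl_into_rtrancl)
        qed
      qed (use self_in_side assms arc_sym in auto)
    qed
  qed
  moreover have "side T u v \<inter> side T v u = {}"
  proof (rule equals0I)
    fix w
    assume "w \<in> side T u v \<inter> side T v u"
    moreover have "u \<notin> side T v u"
      by (simp add: side_def)
    ultimately show False
      using side_cases[of w u v] side_disjoint assms arc_sym by blast
  qed
  moreover have "side T v u \<subseteq> pverts T"
    by (auto simp: side_def)
  ultimately show ?thesis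
    by blast
qed

lemma edge_side_complement:
  assumes "(u, v) \<in> parcs T" "\<phi> ` fst M \<subseteq> pverts T"
  shows "edge_side M T \<phi> v u = fst M - edge_side M T \<phi> u v"
  unfolding edge_side_eq[OF graph assms(1)] edge_side_eq[OF graph arc_sym[OF assms(1)]]
    side_complement[OF assms(1)]
  using assms(2) by auto

lemma degree_eq: "degree T u = card {w. (w, u) \<in> parcs T}"
proof -
  have "out_arcs (with_proj T) u = Pair u ` {w. (w, u) \<in> parcs T}"
    using arc_sym by (auto simp: out_arcs_def)
  then show ?thesis
    by (simp add: out_degree_def card_image inj_on_def)
qed

end

section \<open>From bounded decomposition-width to an automaton\<close>

text \<open>A rooted binary tree remembered only through the sets of elements below its vertices.
  Every such set must belong to \<open>D\<close>, so that a bound on the number of classes is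
  available at every vertex.\<close>

inductive tree_built :: "'a set set \<Rightarrow> 'a set \<Rightarrow> bool" for D where
  singleton: "{x} \<in> D \<Longrightarrow> tree_built D {x}"
| union: "tree_built D U \<Longrightarrow> tree_built D V \<Longrightarrow> U \<inter> V = {} \<Longrightarrow> U \<union> V \<in> D \<Longrightarrow>
    tree_built D (U \<union> V)"

lemma tree_built_mem: "tree_built D U \<Longrightarrow> U \<in> D"
  by (induction rule: tree_built.induct) auto

lemma tree_built_mono: "tree_built D U \<Longrightarrow> D \<subseteq> D' \<Longrightarrow> tree_built D' U"
  by (induction rule: tree_built.induct) (auto intro: tree_built.intros)

context undirected_tree_graph
begin

text \<open>Read the arc from \<open>u\<close> to \<open>v\<close> as pointing to the parent. Then
  \<open>u\<close> is a leaf, or its two other neighbours act as children whose sides are disjoint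
  and strictly smaller, which drives the induction on the size of the side.\<close>

lemma tree_built_edge_side:
  assumes sub: "subcubic_tree T" and phi: "bij_betw \<phi> (fst M) (subcubic_leaves T)"
    and "(u, v) \<in> parcs T"
  shows "tree_built (displayed_sets M T \<phi>) (edge_side M T \<phi> u v)"
  using assms(3)
proof (induction "card (side T u v)" arbitrary: u v rule: less_induct)
  case less
  note side_eq = edge_side_eq[OF graph]
  have displayed: "edge_side M T \<phi> u v \<in> displayed_sets M T \<phi>"
    using less.prems by (auto simp: displayed_sets_def)
  let ?N = "{w. (w, u) \<in> parcs T}"
  have v: "v \<in> ?N" and uv: "u \<noteq> v" "u \<in> pverts T" "v \<in> pverts T"
    using less.prems arc_sym arc_neq arcs_verts by auto
  have "card (pverts T) \<noteq> 1"
    using uv by (auto simp: card_1_singleton_iff)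
  then have "degree T u = 3 \<or> degree T u = 1"
    using sub uv by (auto simp: subcubic_tree_def)
  then consider "card ?N = 1" | "card ?N = 3"
    by (auto simp: degree_eq)
  then show ?case
  proof cases
    case 1
    then have "?N = {v}"
      using v by (metis card_1_singletonE singletonD)
    \<comment> \<open>By \<open>side_cases\<close>, any other vertex would need a neighbour of
      \<open>u\<close> different from \<open>v\<close>.\<close>
    then have "side T u v = {u}"
      using side_cases[OF _ less.prems] self_in_side[OF less.prems] by blast
    have "u \<in> subcubic_leaves T"
      using 1 uv by (auto simp: subcubic_leaves_def degree_eq)
    then have "u \<in> \<phi> ` fst M"
      using bij_betw_imp_surj_on[OF phi] by simp
    then obtain x where x: "x \<in> fst M" "\<phi> x = u"
      by (metis imageE)
    have "edge_side M T \<phi> u v = {y \<in> fst M. \<phi> y = \<phi> x}"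
      unfolding side_eq[OF less.prems] by (simp only: \<open>side T u v = {u}\<close> x singleton_iff)
    also have "\<dots> = {x}"
      using inj_onD[OF bij_betw_imp_inj_on[OF phi]] x(1) by blast
    finally have "edge_side M T \<phi> u v = {x}" .
    with displayed show ?thesis
      by (auto intro: tree_built.singleton)
  next
    case 2
    then have fin: "finite ?N"
      by (metis card.infinite zero_neq_numeral)
    then have "card (?N - {v}) = 2"
      using 2 v by simp
    then obtain a b where ab: "?N - {v} = {a, b}" "a \<noteq> b"
      by (auto simp: card_2_iff)
    then have a: "(a, u) \<in> parcs T" "a \<noteq> v" and b: "(b, u) \<in> parcs T" "b \<noteq> v"
      by auto
    have sub_a: "side T a u \<subset> side T u v" and sub_b: "side T b u \<subset> side T u v"
      using side_subset[OF a(1) less.prems a(2)] side_subset[OF b(1) less.prems b(2)]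
        self_in_side[OF less.prems] by (auto simp: side_def)
    have "finite (side T u v)"
      using finite_verts by (simp add: side_def)
    then have "card (side T a u) < card (side T u v)" "card (side T b u) < card (side T u v)"
      using sub_a sub_b by (auto intro: psubset_card_mono)
    then have IH: "tree_built (displayed_sets M T \<phi>) (edge_side M T \<phi> a u)"
      "tree_built (displayed_sets M T \<phi>) (edge_side M T \<phi> b u)"
      using less.hyps a(1) b(1) by auto
    have split: "side T u v = insert u (side T a u \<union> side T b u)"
    proof
      show "side T u v \<subseteq> insert u (side T a u \<union> side T b u)"
      proof
        fix w
        assume "w \<in> side T u v"
        then consider "w = u" | c where "c \<in> ?N - {v}" "w \<in> side T c u"
          using side_cases[OF _ less.prems] by blast
        then show "w \<in> insert u (side T a u \<union> side T b u)"
          by cases (auto simp: ab(1))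
      qed
      show "insert u (side T a u \<union> side T b u) \<subseteq> side T u v"
        using sub_a sub_b self_in_side[OF less.prems] by auto
    qed
    \<comment> \<open>The side also contains \<open>u\<close>, but no element is placed there, so
      passing to elements leaves just the two branches.\<close>
    have "u \<notin> subcubic_leaves T"
      using 2 uv by (auto simp: subcubic_leaves_def degree_eq)
    then have "\<phi> x \<noteq> u" if "x \<in> fst M" for x
      using bij_betwE[OF phi] that by blast
    then have eq: "edge_side M T \<phi> u v = edge_side M T \<phi> a u \<union> edge_side M T \<phi> b u"
      unfolding side_eq[OF less.prems] side_eq[OF a(1)] side_eq[OF b(1)] split by blast
    have "edge_side M T \<phi> a u \<inter> edge_side M T \<phi> b u = {}"
      using side_disjoint[OF a(1) b(1) ab(2)]
      unfolding side_eq[OF a(1)] side_eq[OF b(1)] by blast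
    with IH displayed show ?thesis
      unfolding eq by (intro tree_built.union)
  qed
qed

end

text \<open>Any edge can carry the root: its two sides partition the ground set. The ground set need
  not be displayed, which is why it is inserted explicitly.\<close>

lemma tree_built_ground_set:
  assumes "decomposition M T \<phi>"
  shows "tree_built (insert (fst M) (displayed_sets M T \<phi>)) (fst M)"
proof -
  have sub: "subcubic_tree T" and phi: "bij_betw \<phi> (fst M) (subcubic_leaves T)"
    using assms by (auto simp: decomposition_def)
  interpret undirected_tree_graph T
    by unfold_locales (use sub in \<open>simp add: subcubic_tree_def\<close>)
  show ?thesis
  proof (cases "parcs T = {}")
    case False
    then obtain u v where uv: "(u, v) \<in> parcs T"
      by auto
    let ?U = "edge_side M T \<phi> u v" and ?V = "edge_side M T \<phi> v u"
    have "\<phi> ` fst M \<subseteq> pverts T"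
      using phi by (auto simp: bij_betw_def subcubic_leaves_def)
    then have V: "?V = fst M - ?U"
      by (rule edge_side_complement[OF uv])
    then have E: "?U \<union> ?V = fst M" "?U \<inter> ?V = {}"
      by (auto simp: edge_side_def)
    have "tree_built (insert (fst M) (displayed_sets M T \<phi>)) (?U \<union> ?V)"
      using tree_built_edge_side[OF sub phi uv] tree_built_edge_side[OF sub phi arc_sym[OF uv]] E
      by (intro tree_built.union) (auto intro: tree_built_mono)
    then show ?thesis
      by (simp only: E)
  next
    case True
    \<comment> \<open>Degree 0 is neither 1 nor 3 and the vertex set is non-empty, so only the
      one-vertex alternative of \<open>subcubic_tree\<close> remains.\<close>
    then have "degree T v = 0" for v
      by (simp add: degree_eq)
    then have "card (pverts T) = 1"
      using sub tree graph connected_iff_rtrancl[OF graph]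
      by (force simp: subcubic_tree_def undirected_tree_def)
    then obtain t where "pverts T = {t}"
      by (auto simp: card_1_singleton_iff)
    then have "subcubic_leaves T = {t}"
      by (auto simp: subcubic_leaves_def)
    then have "card (fst M) = 1"
      using bij_betw_same_card[OF phi] by simp
    then obtain x where "fst M = {x}"
      by (auto simp: card_1_singleton_iff)
    then show ?thesis
      by (simp add: tree_built.singleton)
  qed
qed

section \<open>Equivalence of sets as a congruence\<close>

lemma equiv_set_equiv: "equiv (Pow U) (set_equiv M U)"
  by (auto simp: equiv_def refl_on_def sym_def trans_def set_equiv_def)

lemma set_equivD:
  "(X, X') \<in> set_equiv M U \<Longrightarrow> Z \<subseteq> fst M - U \<Longrightarrow> X \<union> Z \<in> snd M \<longleftrightarrow> X' \<union> Z \<in> snd M"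
  by (simp add: set_equiv_def)

text \<open>Exchange one part at a time: first \<open>X\<close> for \<open>X'\<close> with
  \<open>Y \<union> Z\<close> as the outside set, then \<open>Y\<close> for \<open>Y'\<close> with
  \<open>X' \<union> Z\<close>. Disjointness of \<open>U\<close> and \<open>V\<close> makes both
  sets admissible.\<close>

lemma set_equiv_union:
  assumes "U \<union> V \<subseteq> fst M" "U \<inter> V = {}"
    and "(X, X') \<in> set_equiv M U" "(Y, Y') \<in> set_equiv M V"
  shows "(X \<union> Y, X' \<union> Y') \<in> set_equiv M (U \<union> V)"
proof -
  have X: "X \<subseteq> U" "X' \<subseteq> U" and Y: "Y \<subseteq> V" "Y' \<subseteq> V"
    using assms by (auto simp: set_equiv_def)
  have "X \<union> Y \<union> Z \<in> snd M \<longleftrightarrow> X' \<union> Y' \<union> Z \<in> snd M" if Z: "Z \<subseteq> fst M - (U \<union> V)" for Z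
  proof -
    have "X \<union> (Y \<union> Z) \<in> snd M \<longleftrightarrow> X' \<union> (Y \<union> Z) \<in> snd M"
      using assms Y Z by (intro set_equivD[OF assms(3)]) blast
    moreover have "Y \<union> (X' \<union> Z) \<in> snd M \<longleftrightarrow> Y' \<union> (X' \<union> Z) \<in> snd M"
      using assms X Z by (intro set_equivD[OF assms(4)]) blast
    ultimately show ?thesis
      by (simp add: Un_ac)
  qed
  then show ?thesis
    using X Y by (auto simp: set_equiv_def)
qed

section \<open>An automaton that evaluates tables\<close>

definition tables :: "nat \<Rightarrow> (nat \<times> nat \<Rightarrow> nat) set" where
  "tables K = {..<K} \<times> {..<K} \<rightarrow>\<^sub>E {..<K}"

text \<open>
  The letter \<open>s\<close> stands for the table \<open>h s\<close>. A leaf reads the entry at \<open>(0, 0)\<close> or \<open>(0, 1)\<close>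
  according to whether its element is absent or present, whence the need for \<open>2 \<le> K\<close>.
\<close>

definition table_automaton ::
    "nat \<Rightarrow> nat set \<Rightarrow> (nat \<Rightarrow> nat \<times> nat \<Rightarrow> nat) \<Rightarrow> (nat enc_letter, nat) automaton" where
  "table_automaton K \<Sigma> h =
     \<lparr>alphabet = \<Sigma> <+> \<Sigma> \<times> ({1} \<rightarrow>\<^sub>E {0, 1}), states = {..<K}, accepting = {0},
      delta0 = (\<lambda>s. case s of Inl _ \<Rightarrow> None
        | Inr (s, b) \<Rightarrow> if s \<in> \<Sigma> \<and> b \<in> {1} \<rightarrow>\<^sub>E {0, 1} then Some {h s (0, b 1)} else None),
      delta2 = (\<lambda>(s, q, q'). case s of Inr _ \<Rightarrow> None
        | Inl s \<Rightarrow> if s \<in> \<Sigma> \<and> q < K \<and> q' < K then Some {h s (q, q')} else None)\<rparr>"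

lemma ary_table_automaton:
  assumes "finite \<Sigma>" "h ` \<Sigma> \<subseteq> tables K" "2 \<le> K"
  shows "ary_automaton 1 \<Sigma> (table_automaton K \<Sigma> h)"
proof -
  have h: "h s (q, q') < K" if "s \<in> \<Sigma>" "q < K" "q' < K" for s q q'
    using assms(2) that by (force simp: tables_def)
  have b: "b 1 < K" if "b \<in> {1} \<rightarrow>\<^sub>E {0, 1 :: nat}" for b :: "nat \<Rightarrow> nat"
    using that assms(3) by (auto simp: PiE_def Pi_def)
  let ?B = "{1} \<rightarrow>\<^sub>E {0, 1 :: nat}" and ?A = "table_automaton K \<Sigma> h"
  have "finite (\<Sigma> <+> \<Sigma> \<times> ?B)"
    using assms(1) by (intro finite_Plus finite_SigmaI finite_PiE) auto
  moreover have dom0: "dom (delta0 ?A) \<subseteq> Inr ` (\<Sigma> \<times> ?B)"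
  proof
    fix x
    assume "x \<in> dom (delta0 ?A)"
    then show "x \<in> Inr ` (\<Sigma> \<times> ?B)"
      by (cases x) (auto simp: table_automaton_def split: if_splits)
  qed
  moreover have "dom (delta0 ?A) \<subseteq> \<Sigma> <+> \<Sigma> \<times> ?B"
    using dom0 unfolding Plus_def by (rule le_supI2)
  moreover have "R \<subseteq> {..<K}" if "delta0 ?A x = Some R" for x R
    using that h b assms(3) by (cases x) (auto simp: table_automaton_def split: if_splits)
  then have "ran (delta0 ?A) \<subseteq> Pow {..<K}"
    unfolding ran_def by blast
  moreover have "dom (delta2 ?A) \<subseteq> (\<Sigma> <+> \<Sigma> \<times> ?B) \<times> {..<K} \<times> {..<K}"
  proof
    fix x
    assume "x \<in> dom (delta2 ?A)"
    then show "x \<in> (\<Sigma> <+> \<Sigma> \<times> ?B) \<times> {..<K} \<times> {..<K}"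
      by (cases x; cases "fst x") (auto simp: table_automaton_def split: if_splits)
  qed
  moreover have "R \<subseteq> {..<K}" if "delta2 ?A x = Some R" for x R
    using that h by (cases x; cases "fst x") (auto simp: table_automaton_def split: if_splits)
  then have "ran (delta2 ?A) \<subseteq> Pow {..<K}"
    unfolding ran_def by blast
  moreover have "alphabet ?A = \<Sigma> <+> \<Sigma> \<times> ?B" "states ?A = {..<K}" "accepting ?A = {0}"
    by (simp_all add: table_automaton_def)
  moreover have "{0} \<subseteq> {..<K}"
    using assms(3) by simp
  ultimately show ?thesis
    using assms(1) unfolding ary_automaton_def tree_automaton_def
    by (simp only: finite_lessThan simp_thms)
qed

lemma table_automaton_leaf_step:
  "s \<in> \<Sigma> \<Longrightarrow> b \<in> {1} \<rightarrow>\<^sub>E {0, 1} \<Longrightarrow>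
    leaf_step (table_automaton K \<Sigma> h) (Inr (s, b)) = {h s (0, b 1)}"
  by (simp add: leaf_step_def table_automaton_def)

lemma table_automaton_node_step:
  "s \<in> \<Sigma> \<Longrightarrow> q < K \<Longrightarrow> q' < K \<Longrightarrow>
    node_step (table_automaton K \<Sigma> h) (Inl s) {q} {q'} = {h s (q, q')}"
  by (simp add: node_step_def table_automaton_def)

lemma run_Node_Nil:
  "run A (Node l r) \<sigma> [] = node_step A (\<sigma> []) (run A l (\<lambda>w. \<sigma> (Lft # w)) []) (run A r (\<lambda>w. \<sigma> (Rgt # w)) [])"
  by simp

text \<open>Makes the induction hypotheses for the children applicable: seen from a child, the
  encoding of \<open>X\<close> in the joint tree is that child's own encoding of the trace of
  \<open>X\<close>. Disjointness is what lets the two leaf bijections be glued by a case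
  distinction.\<close>

lemma enc_Node:
  assumes "bij_betw \<phi>1 U (leaves l)" "bij_betw \<phi>2 V (leaves r)" "U \<inter> V = {}"
  defines "\<phi> \<equiv> \<lambda>x. if x \<in> U then Lft # \<phi>1 x else Rgt # \<phi>2 x"
  shows "bij_betw \<phi> (U \<union> V) (leaves (Node l r))"
    and "enc i (U \<union> V) (Node l r) \<sigma> \<phi> X (Lft # w) = enc i U l (\<lambda>w. \<sigma> (Lft # w)) \<phi>1 (X \<inter> U) w"
    and "enc i (U \<union> V) (Node l r) \<sigma> \<phi> X (Rgt # w) = enc i V r (\<lambda>w. \<sigma> (Rgt # w)) \<phi>2 (X \<inter> V) w"
    and "enc i (U \<union> V) (Node l r) \<sigma> \<phi> X [] = Inl (\<sigma> [])"
proof -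
  show bij: "bij_betw \<phi> (U \<union> V) (leaves (Node l r))"
  proof -
    have "bij_betw \<phi> U (Cons Lft ` leaves l)"
      using assms(1) by (auto simp: \<phi>_def bij_betw_def inj_on_def)
    moreover have "bij_betw \<phi> V (Cons Rgt ` leaves r)"
    proof -
      have "bij_betw (\<lambda>x. Rgt # \<phi>2 x) V (Cons Rgt ` leaves r)"
        using assms(2) by (auto simp: bij_betw_def inj_on_def)
      moreover have "\<phi> x = Rgt # \<phi>2 x" if "x \<in> V" for x
        using that assms(3) by (auto simp: \<phi>_def)
      ultimately show ?thesis
        by (simp cong: bij_betw_cong)
    qed
    moreover have "Cons Lft ` leaves l \<inter> Cons Rgt ` leaves r = {}"
      by auto
    ultimately show ?thesis
      by (simp add: bij_betw_combine)
  qed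
  show "enc i (U \<union> V) (Node l r) \<sigma> \<phi> X (Lft # w) = enc i U l (\<lambda>w. \<sigma> (Lft # w)) \<phi>1 (X \<inter> U) w"
  proof (cases "w \<in> leaves l")
    case True
    then obtain x where x: "x \<in> U" "w = \<phi>1 x"
      using assms(1) by (auto simp: bij_betw_def)
    then have "inv_into U \<phi>1 w = x"
      using assms(1) by (simp add: bij_betw_def inv_into_f_f)
    moreover have "\<phi> x = Lft # w"
      using x by (simp add: \<phi>_def)
    then have "inv_into (U \<union> V) \<phi> (Lft # w) = x"
      using bij x inv_into_f_f[of \<phi> "U \<union> V" x] by (auto simp: bij_betw_def)
    ultimately show ?thesis
      using True x by (simp add: enc_def)
  qed (auto simp: enc_def)
  show "enc i (U \<union> V) (Node l r) \<sigma> \<phi> X (Rgt # w) = enc i V r (\<lambda>w. \<sigma> (Rgt # w)) \<phi>2 (X \<inter> V) w"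
  proof (cases "w \<in> leaves r")
    case True
    then obtain x where x: "x \<in> V" "w = \<phi>2 x"
      using assms(2) by (auto simp: bij_betw_def)
    then have "inv_into V \<phi>2 w = x"
      using assms(2) by (simp add: bij_betw_def inv_into_f_f)
    moreover have "\<phi> x = Rgt # w"
      using x assms(3) by (auto simp: \<phi>_def)
    then have "inv_into (U \<union> V) \<phi> (Rgt # w) = x"
      using bij x inv_into_f_f[of \<phi> "U \<union> V" x] by (auto simp: bij_betw_def)
    ultimately show ?thesis
      using True x by (simp add: enc_def)
  qed (auto simp: enc_def)
  show "enc i (U \<union> V) (Node l r) \<sigma> \<phi> X [] = Inl (\<sigma> [])"
    by (auto simp: enc_def)
qed

text \<open>By \<open>cong\<close>, the number of \<open>X \<union> Y\<close> depends only on the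
  numbers of \<open>X\<close> and \<open>Y\<close>, hence is given by a table; since
  \<open>h\<close> reaches every table, some letter performs the computation. Stated for an
  arbitrary numbering \<open>f\<close>, so that the induction does not involve the
  set-system.\<close>

lemma table_automaton_computes:
  fixes f :: "'a set \<Rightarrow> 'a set \<Rightarrow> nat"
  assumes built: "tree_built D W" and K: "2 \<le> K" and h: "h ` \<Sigma> = tables K"
    and f: "\<And>U X. U \<in> D \<Longrightarrow> X \<subseteq> U \<Longrightarrow> f U X < K"
    and cong: "\<And>U V X X' Y Y'. U \<in> D \<Longrightarrow> V \<in> D \<Longrightarrow> U \<union> V \<in> D \<Longrightarrow> U \<inter> V = {} \<Longrightarrow>
      X \<subseteq> U \<Longrightarrow> X' \<subseteq> U \<Longrightarrow> Y \<subseteq> V \<Longrightarrow> Y' \<subseteq> V \<Longrightarrow> f U X = f U X' \<Longrightarrow> f V Y = f V Y' \<Longrightarrow>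
      f (U \<union> V) (X \<union> Y) = f (U \<union> V) (X' \<union> Y')"
  shows "\<exists>T \<sigma> \<phi>. sigma_tree \<Sigma> T \<sigma> \<and> bij_betw \<phi> W (leaves T) \<and>
    (\<forall>X \<subseteq> W. run (table_automaton K \<Sigma> h) T (enc 1 W T \<sigma> \<phi> X) [] = {f W X})"
  using built
proof (induction rule: tree_built.induct)
  case (singleton x)
  \<comment> \<open>A leaf queries only \<open>(0, 0)\<close> and \<open>(0, 1)\<close>; the
    remaining entries just have to be smaller than \<open>K\<close>.\<close>
  define t where "t = (\<lambda>q \<in> {..<K} \<times> {..<K}. if q = (0, 1) then f {x} {x} else f {x} {})"
  have "t \<in> tables K"
    using f[OF singleton] K by (auto simp: tables_def t_def)
  then have "t \<in> h ` \<Sigma>"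
    by (simp only: h)
  then obtain s where s: "h s = t" "s \<in> \<Sigma>"
    by (metis imageE)
  have hs: "h s (0, 1) = f {x} {x}" "h s (0, 0) = f {x} {}"
    using s K by (auto simp: t_def)
  define \<phi> :: "'a \<Rightarrow> position" where "\<phi> = (\<lambda>_. [])"
  have inv: "inv_into {x} \<phi> [] = x"
    using inv_into_f_f[of \<phi> "{x}" x] by (simp add: \<phi>_def)
  have "run (table_automaton K \<Sigma> h) Leaf (enc 1 {x} Leaf (\<lambda>_. s) \<phi> X) [] = {f {x} X}"
    if "X \<subseteq> {x}" for X
  proof -
    have "X = {} \<or> X = {x}"
      using that by auto
    then show ?thesis
      using s(2) hs by (auto simp: enc_def inv table_automaton_leaf_step)
  qed
  moreover have "sigma_tree \<Sigma> Leaf (\<lambda>_. s)" "bij_betw \<phi> {x} (leaves Leaf)"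
    using s(2) by (auto simp: sigma_tree_def bij_betw_def \<phi>_def)
  ultimately show ?case
    by (intro exI[of _ Leaf] exI[of _ "\<lambda>_. s"] exI[of _ \<phi>] conjI allI impI)
next
  case (union U V)
  obtain l \<sigma>1 \<phi>1 where l: "sigma_tree \<Sigma> l \<sigma>1" "bij_betw \<phi>1 U (leaves l)"
    "\<And>X. X \<subseteq> U \<Longrightarrow> run (table_automaton K \<Sigma> h) l (enc 1 U l \<sigma>1 \<phi>1 X) [] = {f U X}"
    using union.IH(1) by (elim exE conjE) metis
  obtain r \<sigma>2 \<phi>2 where r: "sigma_tree \<Sigma> r \<sigma>2" "bij_betw \<phi>2 V (leaves r)"
    "\<And>X. X \<subseteq> V \<Longrightarrow> run (table_automaton K \<Sigma> h) r (enc 1 V r \<sigma>2 \<phi>2 X) [] = {f V X}"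
    using union.IH(2) by (elim exE conjE) metis
  have D: "U \<in> D" "V \<in> D"
    using union tree_built_mem by auto
  \<comment> \<open>\<open>P\<close> says that a pair of sets has the numbers \<open>q\<close> and
    \<open>q'\<close>; \<open>F\<close> picks one such pair to represent all of them.\<close>
  define P where "P = (\<lambda>q q' XY. fst XY \<subseteq> U \<and> snd XY \<subseteq> V \<and> f U (fst XY) = q \<and> f V (snd XY) = q')"
  define F where "F = (\<lambda>q q'. SOME XY. P q q' XY)"
  have F: "P q q' (F q q')" if "P q q' XY" for q q' XY
    unfolding F_def using that by (rule someI)
  \<comment> \<open>If no pair of sets has these numbers, \<open>F\<close> is meaningless. The test
    guards against this, and 0 is an arbitrary value below \<open>K\<close>.\<close>
  define t where "t = (\<lambda>(q, q') \<in> {..<K} \<times> {..<K}. if P q q' (F q q')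
    then f (U \<union> V) (fst (F q q') \<union> snd (F q q')) else 0)"
  have t: "t (f U X, f V Y) = f (U \<union> V) (X \<union> Y)" if XY: "X \<subseteq> U" "Y \<subseteq> V" for X Y
  proof -
    let ?XY = "F (f U X) (f V Y)"
    have "P (f U X) (f V Y) (X, Y)"
      using XY by (simp add: P_def)
    then have P: "P (f U X) (f V Y) ?XY"
      by (rule F)
    then have "f (U \<union> V) (fst ?XY \<union> snd ?XY) = f (U \<union> V) (X \<union> Y)"
      using XY by (intro cong[OF D union.hyps(4,3)]) (simp_all add: P_def)
    then show ?thesis
      using P f[OF D(1) XY(1)] f[OF D(2) XY(2)] by (simp add: t_def)
  qed
  have "t (q, q') < K" if "q < K" "q' < K" for q q'
  proof (cases "P q q' (F q q')")
    case True
    then have "fst (F q q') \<union> snd (F q q') \<subseteq> U \<union> V"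
      unfolding P_def by blast
    then show ?thesis
      using that True f[OF union.hyps(4)] by (simp add: t_def)
  next
    case False
    then show ?thesis
      using that K by (simp add: t_def)
  qed
  then have "t \<in> tables K"
    unfolding tables_def by (intro PiE_I) (auto simp: t_def)
  then have "t \<in> h ` \<Sigma>"
    by (simp only: h)
  then obtain s where s: "h s = t" "s \<in> \<Sigma>"
    by (metis imageE)
  define \<sigma> where "\<sigma> = (\<lambda>p. case p of [] \<Rightarrow> s | Lft # w \<Rightarrow> \<sigma>1 w | Rgt # w \<Rightarrow> \<sigma>2 w)"
  define \<phi> where "\<phi> = (\<lambda>x. if x \<in> U then Lft # \<phi>1 x else Rgt # \<phi>2 x)"
  note enc = enc_Node[OF l(2) r(2) union.hyps(3), folded \<phi>_def]
  have "run (table_automaton K \<Sigma> h) (Node l r) (enc 1 (U \<union> V) (Node l r) \<sigma> \<phi> X) [] = {f (U \<union> V) X}"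
    if X: "X \<subseteq> U \<union> V" for X
  proof -
    have "t (f U (X \<inter> U), f V (X \<inter> V)) = f (U \<union> V) X"
      using t[of "X \<inter> U" "X \<inter> V"] X by (simp add: Int_Un_distrib[symmetric] Int_absorb2)
    moreover have "f U (X \<inter> U) < K" "f V (X \<inter> V) < K"
      using f D by auto
    moreover have "\<sigma> [] = s" "(\<lambda>w. \<sigma> (Lft # w)) = \<sigma>1" "(\<lambda>w. \<sigma> (Rgt # w)) = \<sigma>2"
      by (simp_all add: \<sigma>_def)
    ultimately show ?thesis
      unfolding run_Node_Nil enc using s
      by (simp only: l(3)[OF Int_lower2] r(3)[OF Int_lower2] table_automaton_node_step)
  qed
  moreover have "sigma_tree \<Sigma> (Node l r) \<sigma>"
    using l(1) r(1) s(2) by (auto simp: sigma_tree_def \<sigma>_def)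
  ultimately show ?case
    using enc(1)
    by (intro exI[of _ "Node l r"] exI[of _ \<sigma>] exI[of _ \<phi>] conjI allI impI)
qed

section \<open>Numbering the classes of a decomposition\<close>

lemma finite_displayed_sets: "pair_graph T \<Longrightarrow> finite (displayed_sets M T \<phi>)"
  unfolding displayed_sets_def using pair_graphD(3)[of T] by auto

lemma decomposition_dw_bound:
  "pair_graph T \<Longrightarrow> U \<in> displayed_sets M T \<phi> \<Longrightarrow>
    card (Pow U // set_equiv M U) \<le> decomposition_dw M T \<phi>"
  unfolding decomposition_dw_def by (intro Max_ge) (auto simp: finite_displayed_sets)

text \<open>At a displayed set there are at most \<open>K\<close> classes, so an injection into the
  numbers below \<open>K\<close> exists. The ground set is not covered by the width and gets its own
  rule.\<close>

lemma class_numbering: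
  assumes M: "set_system M" and dec: "decomposition M T \<phi>"
    and K: "decomposition_dw M T \<phi> \<le> K" "2 \<le> K"
  defines "D \<equiv> insert (fst M) (displayed_sets M T \<phi>)"
  obtains f where "\<And>U X. U \<in> D \<Longrightarrow> X \<subseteq> U \<Longrightarrow> f U X < K"
    and "\<And>U X X'. U \<in> D \<Longrightarrow> X \<subseteq> U \<Longrightarrow> X' \<subseteq> U \<Longrightarrow> f U X = f U X' \<longleftrightarrow> (X, X') \<in> set_equiv M U"
    and "\<And>X. X \<subseteq> fst M \<Longrightarrow> f (fst M) X = 0 \<longleftrightarrow> X \<in> snd M"
proof -
  have T: "pair_graph T"
    using dec by (simp add: decomposition_def subcubic_tree_def undirected_tree_def)
  have E: "finite (fst M)"
    using M by (simp add: set_system_def)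
  have "\<exists>g. inj_on g (Pow U // set_equiv M U) \<and> g ` (Pow U // set_equiv M U) \<subseteq> {..<K}"
    if U: "U \<in> displayed_sets M T \<phi>" for U
  proof -
    have "U \<subseteq> fst M"
      using U by (auto simp: displayed_sets_def edge_side_def)
    then have "finite (Pow U // set_equiv M U)"
      using E finite_subset
      by (intro finite_quotient) (auto simp: set_equiv_def)
    moreover have "card (Pow U // set_equiv M U) \<le> card {..<K}"
      using decomposition_dw_bound[OF T U] K by simp
    ultimately show ?thesis
      by (metis card_le_inj finite_lessThan)
  qed
  then obtain g where g: "\<And>U. U \<in> displayed_sets M T \<phi> \<Longrightarrow> inj_on (g U) (Pow U // set_equiv M U)"
    "\<And>U. U \<in> displayed_sets M T \<phi> \<Longrightarrow> g U ` (Pow U // set_equiv M U) \<subseteq> {..<K}"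
    by metis
  \<comment> \<open>On the ground set only the empty \<open>Z\<close> is allowed, so the class is
    decided by membership. Members get 0, the accepting state of
    \<open>table_automaton\<close>.\<close>
  define f where "f = (\<lambda>U X. if U = fst M then of_bool (X \<notin> snd M) else g U (set_equiv M U `` {X}))"
  show ?thesis
  proof (rule that[of f])
    fix U X
    assume "U \<in> D" "X \<subseteq> U"
    then show "f U X < K"
      using g(2)[of U] K(2) by (auto simp: f_def D_def intro!: quotientI)
  next
    fix U X X'
    assume UX: "U \<in> D" "X \<subseteq> U" "X' \<subseteq> U"
    show "f U X = f U X' \<longleftrightarrow> (X, X') \<in> set_equiv M U"
    proof (cases "U = fst M")
      case True
      then show ?thesis
        using UX by (auto simp: f_def set_equiv_def)
    next
      case False
      moreover have "set_equiv M U `` {X} \<in> Pow U // set_equiv M U"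
        "set_equiv M U `` {X'} \<in> Pow U // set_equiv M U"
        using UX by (simp_all add: quotientI)
      ultimately have "f U X = f U X' \<longleftrightarrow> set_equiv M U `` {X} = set_equiv M U `` {X'}"
        using UX(1) inj_on_eq_iff[OF g(1)[of U]] by (simp add: f_def D_def)
      also have "\<dots> \<longleftrightarrow> (X, X') \<in> set_equiv M U"
        using UX by (intro eq_equiv_class_iff[OF equiv_set_equiv]) auto
      finally show ?thesis .
    qed
  next
    fix X
    show "f (fst M) X = 0 \<longleftrightarrow> X \<in> snd M"
      by (simp add: f_def)
  qed
qed

text \<open>The automaton depends on \<open>K\<close>, \<Sigma> and \<open>h\<close> alone;
  everything specific to \<open>M\<close> goes into the labelled tree. At the root the run is the
  singleton of the number of \<open>X\<close>, and this is 0 exactly for members.\<close>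

lemma encoded_by_table_automaton:
  assumes M: "set_system M" and dec: "decomposition M T \<phi>"
    and K: "decomposition_dw M T \<phi> \<le> K" "2 \<le> K" and h: "h ` \<Sigma> = tables K"
  shows "\<exists>T \<sigma> \<phi>. sigma_tree \<Sigma> T \<sigma> \<and> bij_betw \<phi> (fst M) (leaves T) \<and>
    M = encoded_set_system 1 (table_automaton K \<Sigma> h) (fst M) T \<sigma> \<phi>"
proof -
  let ?D = "insert (fst M) (displayed_sets M T \<phi>)"
  obtain f where f: "\<And>U X. U \<in> ?D \<Longrightarrow> X \<subseteq> U \<Longrightarrow> f U X < K"
    "\<And>U X X'. U \<in> ?D \<Longrightarrow> X \<subseteq> U \<Longrightarrow> X' \<subseteq> U \<Longrightarrow> f U X = f U X' \<longleftrightarrow> (X, X') \<in> set_equiv M U"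
    "\<And>X. X \<subseteq> fst M \<Longrightarrow> f (fst M) X = 0 \<longleftrightarrow> X \<in> snd M"
    by (rule class_numbering[OF M dec K]) (rule that)
  have D: "U \<subseteq> fst M" if "U \<in> ?D" for U
    using that by (auto simp: displayed_sets_def edge_side_def)
  have cong: "f (U \<union> V) (X \<union> Y) = f (U \<union> V) (X' \<union> Y')"
    if "U \<in> ?D" "V \<in> ?D" "U \<union> V \<in> ?D" "U \<inter> V = {}"
      "X \<subseteq> U" "X' \<subseteq> U" "Y \<subseteq> V" "Y' \<subseteq> V" "f U X = f U X'" "f V Y = f V Y'" for U V X X' Y Y'
  proof -
    have "(X, X') \<in> set_equiv M U" "(Y, Y') \<in> set_equiv M V"
      using that f(2) by blast+
    then have "(X \<union> Y, X' \<union> Y') \<in> set_equiv M (U \<union> V)"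
      using D[OF that(3)] that(4) by (intro set_equiv_union)
    moreover have "X \<union> Y \<subseteq> U \<union> V" "X' \<union> Y' \<subseteq> U \<union> V"
      using that by auto
    ultimately show ?thesis
      using f(2)[OF that(3)] by blast
  qed
  have "\<exists>T \<sigma> \<phi>. sigma_tree \<Sigma> T \<sigma> \<and> bij_betw \<phi> (fst M) (leaves T) \<and>
    (\<forall>X \<subseteq> fst M. run (table_automaton K \<Sigma> h) T (enc 1 (fst M) T \<sigma> \<phi> X) [] = {f (fst M) X})"
    by (rule table_automaton_computes[where f = f and D = ?D,
        OF tree_built_ground_set[OF dec] K(2) h f(1) cong])
  then obtain T' \<sigma> \<phi>' where T': "sigma_tree \<Sigma> T' \<sigma>" "bij_betw \<phi>' (fst M) (leaves T')"
    "\<forall>X \<subseteq> fst M. run (table_automaton K \<Sigma> h) T' (enc 1 (fst M) T' \<sigma> \<phi>' X) [] = {f (fst M) X}"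
    by (elim exE conjE) (rule that)
  have acc: "accepting (table_automaton K \<Sigma> h) = {0}"
    by (simp add: table_automaton_def)
  have "snd M = {Y. Y \<subseteq> fst M \<and> accepts (table_automaton K \<Sigma> h) T' (enc 1 (fst M) T' \<sigma> \<phi>' Y)}"
    using M T'(3) f(3) by (auto simp: accepts_def acc set_system_def)
  then have "M = encoded_set_system 1 (table_automaton K \<Sigma> h) (fst M) T' \<sigma> \<phi>'"
    unfolding encoded_set_system_def by (metis prod.collapse)
  with T'(1,2) show ?thesis
    by (intro exI[of _ T'] exI[of _ \<sigma>] exI[of _ \<phi>'] conjI)
qed

section \<open>The subcubic tree of a rooted tree\<close>

lemma vwalk_arcs_nth: "set (vwalk_arcs p) \<subseteq> R \<Longrightarrow> Suc i < length p \<Longrightarrow> (p ! i, p ! Suc i) \<in> R"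
proof (induction p arbitrary: i rule: vwalk_arcs.induct)
  case (3 x y xs)
  then show ?case
    by (cases i) auto
qed auto

text \<open>The largest vertex of a cycle would have two different neighbours below it.\<close>

lemma no_cycle_if_unique_lower_neighbour:
  fixes T :: "'v :: linorder pair_pre_digraph"
  assumes sym: "sym (parcs T)"
    and lower: "\<And>m n n'. (m, n) \<in> parcs T \<Longrightarrow> (m, n') \<in> parcs T \<Longrightarrow> n \<le> m \<Longrightarrow> n' \<le> m \<Longrightarrow> n = n'"
    and p: "vpath p (with_proj T)" "3 \<le> length p"
  shows "(last p, hd p) \<notin> parcs T"
proof
  assume last: "(last p, hd p) \<in> parcs T"
  have dist: "distinct p" and "p \<noteq> []" and "set (vwalk_arcs p) \<subseteq> parcs T"
    using p by (auto simp: vpath_def vwalk_def)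
  then have step: "(p ! i, p ! Suc i) \<in> parcs T" if "Suc i < length p" for i
    using vwalk_arcs_nth that by blast
  define n where "n = length p"
  have ends: "last p = p ! (n - 1)" "hd p = p ! 0"
    using \<open>p \<noteq> []\<close> by (simp_all add: last_conv_nth hd_conv_nth n_def)
  define m where "m = Max (set p)"
  have "m \<in> set p"
    using \<open>p \<noteq> []\<close> by (simp add: m_def)
  then obtain k where k: "k < n" "p ! k = m"
    by (auto simp: in_set_conv_nth n_def)
  \<comment> \<open>\<open>i\<close> and \<open>j\<close> are the cyclic predecessor and successor
    of the position \<open>k\<close> of the maximum; they differ because the cycle has at least
    three vertices.\<close>
  define i where "i = (if k = 0 then n - 1 else k - 1)"
  define j where "j = (if k = n - 1 then 0 else Suc k)"
  have ij: "i < n" "j < n" "i \<noteq> j"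
    using k(1) p(2) by (auto simp: i_def j_def n_def)
  have "(p ! k, p ! j) \<in> parcs T"
    using step[of k] k(1) last ends by (auto simp: j_def n_def)
  moreover have "(p ! i, p ! k) \<in> parcs T"
    using step[of "k - 1"] k(1) last ends by (cases k) (auto simp: i_def n_def)
  then have "(p ! k, p ! i) \<in> parcs T"
    using sym by (auto simp: sym_def)
  moreover have "p ! i \<le> p ! k" "p ! j \<le> p ! k"
    using ij k by (simp_all add: m_def n_def)
  ultimately have "p ! i = p ! j"
    using lower by blast
  with ij dist show False
    by (simp add: nth_eq_iff_index_eq n_def)
qed

text \<open>
  Heap numbering: the children of \<open>n\<close> are \<open>2 n\<close> and \<open>2 n + 1\<close>. The root, numbered 1, is
  suppressed and its two children are joined by an edge; \<open>toward n\<close> is the neighbour of \<open>n\<close>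
  that is not a child of \<open>n\<close>.
\<close>

definition toward :: "nat \<Rightarrow> nat" where
  "toward n = (if n = 2 then 3 else if n = 3 then 2 else n div 2)"

definition heap_tree :: "nat set \<Rightarrow> nat pair_pre_digraph" where
  "heap_tree V = \<lparr>pverts = V, parcs = {(m, n) \<in> V \<times> V. n = toward m \<or> m = toward n}\<rparr>"

text \<open>Descendants in the heap numbering: dividing by \<open>2 ^ j\<close> drops the last
  \<open>j\<close> binary digits and thereby climbs \<open>j\<close> levels.\<close>

definition below :: "nat \<Rightarrow> nat set" where
  "below k = {n. \<exists>j. n div 2 ^ j = k}"

lemma below_self: "k \<in> below k"
  by (auto simp: below_def intro: exI[of _ 0])

lemma below_div: "n div 2 \<in> below k \<Longrightarrow> n \<in> below k"
proof -
  assume "n div 2 \<in> below k"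
  then obtain j where "n div 2 div 2 ^ j = k"
    by (auto simp: below_def)
  then have "n div 2 ^ Suc j = k"
    by (simp add: div_mult2_eq)
  then show ?thesis
    unfolding below_def by blast
qed

lemma below_cases: "n \<in> below k \<Longrightarrow> n = k \<or> n div 2 \<in> below k"
proof -
  assume "n \<in> below k"
  then obtain j where "n div 2 ^ j = k"
    by (auto simp: below_def)
  then show ?thesis
    by (cases j) (auto simp: below_def div_mult2_eq)
qed

lemma below_le: "n \<in> below k \<Longrightarrow> k \<le> n"
  by (auto simp: below_def)

lemma below_small: "n \<in> below k \<Longrightarrow> n < 4 \<Longrightarrow> 2 \<le> k \<Longrightarrow> n = k"
  using below_cases[of n k] below_le[of "n div 2" k] by linarith

text \<open>Abstracts the numbers of the non-root vertices of a rooted tree with at least two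
  leaves. The graph arguments then need only arithmetic.\<close>

locale heap =
  fixes V :: "nat set"
  assumes finite_V: "finite V"
    and ge_2: "n \<in> V \<Longrightarrow> 2 \<le> n"
    and top: "2 \<in> V" "3 \<in> V"
    and parent: "n \<in> V \<Longrightarrow> 4 \<le> n \<Longrightarrow> n div 2 \<in> V"
    and sibling: "2 \<le> n \<Longrightarrow> 2 * n \<in> V \<longleftrightarrow> 2 * n + 1 \<in> V"
begin

abbreviation H :: "nat pair_pre_digraph" where
  "H \<equiv> heap_tree V"

lemma arc_iff: "(m, n) \<in> parcs H \<longleftrightarrow> m \<in> V \<and> n \<in> V \<and> (n = toward m \<or> m = toward n)"
  by (simp add: heap_tree_def)

lemma pverts_H: "pverts H = V"
  by (simp add: heap_tree_def)

lemma toward_mem: "n \<in> V \<Longrightarrow> toward n \<in> V"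
  using ge_2[of n] parent[of n] top by (auto simp: toward_def)

lemma arc_toward: "n \<in> V \<Longrightarrow> (n, toward n) \<in> parcs H"
  by (simp add: arc_iff toward_mem)

lemma sym_arcs: "sym (parcs H)"
  by (auto simp: sym_def arc_iff)

text \<open>\<open>toward\<close> strictly decreases on vertices other than 2, and on the edge
  between 2 and 3 it maps each end to the other. This gives the uniqueness that excludes
  cycles.\<close>

lemma lower_neighbour:
  assumes "(m, n) \<in> parcs H" "n \<le> m"
  shows "n = toward m"
proof -
  have "2 \<le> m" "2 \<le> n" "n = toward m \<or> m = toward n"
    using assms(1) ge_2 by (auto simp: arc_iff)
  then show ?thesis
    using assms(2) by (auto simp: toward_def split: if_splits)
qed

lemma pair_graph_H: "pair_graph H"
proof (rule pair_graphI)
  show "(v, v) \<notin> parcs H" for v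
    using ge_2[of v] by (auto simp: arc_iff toward_def split: if_splits)
qed (use finite_V sym_arcs in \<open>auto simp: arc_iff pverts_H\<close>)

text \<open>Iterating \<open>toward\<close> descends from every vertex to 2, which settles
  connectedness.\<close>

lemma undirected_tree_H: "undirected_tree H"
proof -
  have to_2: "(n, 2) \<in> (parcs H)\<^sup>*" if "n \<in> V" for n
    using that
  proof (induction n rule: less_induct)
    case (less n)
    show ?case
    proof (cases "n = 2")
      case False
      then have "toward n < n"
        using ge_2[OF less.prems] by (auto simp: toward_def)
      then show ?thesis
        using less toward_mem arc_toward by (blast intro: converse_rtrancl_into_rtrancl)
    qed simp
  qed
  moreover have "(2, n) \<in> (parcs H)\<^sup>*" if "n \<in> V" for n
    using to_2[OF that] sym_rtrancl[OF sym_arcs] by (auto simp: sym_def)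
  ultimately have "Digraph_Component.connected (with_proj H)"
    unfolding connected_iff_rtrancl[OF pair_graph_H] pverts_H
    using top by (meson empty_iff rtrancl_trans)
  moreover have "(last p, hd p) \<notin> parcs H" if "vpath p (with_proj H)" "3 \<le> length p" for p
    using no_cycle_if_unique_lower_neighbour[OF sym_arcs _ that] lower_neighbour by metis
  ultimately show ?thesis
    using pair_graph_H unfolding undirected_tree_def by blast
qed

sublocale undirected_tree_graph H
  by unfold_locales (rule undirected_tree_H)

lemma neighbours_H:
  assumes "u \<in> V"
  shows "{w. (w, u) \<in> parcs H} = insert (toward u) ({2 * u, 2 * u + 1} \<inter> V)"
proof -
  have "w = toward u \<or> w = 2 * u \<or> w = 2 * u + 1" if "(w, u) \<in> parcs H" for w
  proof -
    have "2 \<le> w" "w = toward u \<or> u = toward w"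
      using that ge_2 by (auto simp: arc_iff)
    then show ?thesis
      by (auto simp: toward_def split: if_splits)
  qed
  moreover have "u = toward w" if "w = 2 * u \<or> w = 2 * u + 1" for w
    using that ge_2[OF assms] by (auto simp: toward_def)
  ultimately show ?thesis
    using assms toward_mem by (auto simp: arc_iff)
qed

lemma degree_H:
  assumes "u \<in> V"
  shows "degree H u = (if 2 * u \<in> V then 3 else 1)"
proof -
  have "2 \<le> u"
    by (rule ge_2[OF assms])
  then have "toward u \<noteq> 2 * u" "toward u \<noteq> 2 * u + 1"
    by (auto simp: toward_def)
  with sibling[OF \<open>2 \<le> u\<close>] show ?thesis
    by (auto simp: degree_eq neighbours_H[OF assms])
qed

lemma subcubic_tree_H: "subcubic_tree H"
  using undirected_tree_H degree_H by (auto simp: subcubic_tree_def pverts_H)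

lemma subcubic_leaves_H: "subcubic_leaves H = {u \<in> V. 2 * u \<notin> V}"
proof -
  have "V \<noteq> {v}" for v
    using top by auto
  then show ?thesis
    by (auto simp: subcubic_leaves_def pverts_H degree_H)
qed

text \<open>The arc joining \<open>k\<close> to \<open>toward k\<close> is the only one crossing the
  boundary of \<open>below k\<close>. From 4 on, \<open>toward\<close> is halving and respects
  \<open>below\<close>; the vertices 2 and 3 are checked separately, as each is below no admissible
  number but itself.\<close>

lemma cut_below:
  assumes "(m, n) \<in> parcs H" "n \<in> below k" "m \<notin> below k" "2 \<le> k"
  shows "m = toward k \<and> n = k"
proof -
  have ge: "2 \<le> m" "2 \<le> n" and "n = toward m \<or> m = toward n"
    using assms(1) ge_2 by (auto simp: arc_iff)
  moreover have "toward m < 4" if "m < 4"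
    using that by (simp add: toward_def)
  ultimately consider "n = toward m" "m \<ge> 4" | "n = toward m" "m < 4" "n < 4" |
      "m = toward n" "n \<ge> 4" | "m = toward n" "n < 4"
    by (metis not_le)
  then show ?thesis
  proof cases
    case 1
    then have "m div 2 \<in> below k"
      using assms(2) by (simp add: toward_def)
    then show ?thesis
      using below_div assms(3) by blast
  next
    case 2
    then have "n = k" "m = 2 \<or> m = 3"
      using below_small[OF assms(2) _ assms(4)] ge by auto
    then show ?thesis
      using 2(1) by (auto simp: toward_def)
  next
    case 3
    then show ?thesis
      using below_cases[OF assms(2)] assms(3) by (auto simp: toward_def)
  next
    case 4
    then show ?thesis
      using below_small[OF assms(2) _ assms(4)] by simp
  qed
qed

text \<open>A walk avoiding one end of the arc between \<open>k\<close> and \<open>toward k\<close>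
  cannot use the only crossing arc, so each side stays in its half. As the sides are complementary,
  the two inclusions give equality.\<close>

lemma side_H:
  assumes "k \<in> V"
  shows "side H k (toward k) = V \<inter> below k"
proof -
  note k = ge_2[OF assms] and arc = arc_toward[OF assms]
  have "side H k (toward k) \<subseteq> below k"
  proof
    fix w
    assume "w \<in> side H k (toward k)"
    then have "(w, k) \<in> (avoiding H (toward k))\<^sup>*"
      by (simp add: side_def)
    then show "w \<in> below k"
    proof (induction rule: converse_rtrancl_induct)
      case (step y z)
      then show ?case
        using cut_below[of y z k] k by (auto simp: avoiding_def)
    qed (rule below_self)
  qed
  moreover have "w \<notin> below k" if "w \<in> side H (toward k) k" for w
  proof -
    have "(w, toward k) \<in> (avoiding H k)\<^sup>*"
      using that by (simp add: side_def)
    then show ?thesis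
    proof (induction rule: converse_rtrancl_induct)
      case base
      show ?case
        using k below_le[of "toward k" k] below_small[of "toward k" k]
        by (auto simp: toward_def split: if_splits)
    next
      case (step y z)
      then show ?case
        using cut_below[of z y k] k arc_sym by (auto simp: avoiding_def)
    qed
  qed
  moreover have "side H (toward k) k = V - side H k (toward k)"
    using side_complement[OF arc] by (simp add: pverts_H)
  moreover have "side H k (toward k) \<subseteq> V"
    by (auto simp: side_def pverts_H)
  ultimately show ?thesis
    by blast
qed

lemma displayed_sets_H:
  assumes phi: "\<phi> ` fst M \<subseteq> V" and U: "U \<in> displayed_sets M H \<phi>"
  obtains k where "k \<in> V" "U = {x \<in> fst M. \<phi> x \<in> below k} \<or> U = fst M - {x \<in> fst M. \<phi> x \<in> below k}"
proof -
  have below: "edge_side M H \<phi> k (toward k) = {x \<in> fst M. \<phi> x \<in> below k}"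
    "edge_side M H \<phi> (toward k) k = fst M - {x \<in> fst M. \<phi> x \<in> below k}" if "k \<in> V" for k
  proof -
    show eq: "edge_side M H \<phi> k (toward k) = {x \<in> fst M. \<phi> x \<in> below k}"
      unfolding edge_side_eq[OF pair_graph_H arc_toward[OF that]] side_H[OF that] using phi by auto
    have "\<phi> ` fst M \<subseteq> pverts H"
      using phi by (simp add: pverts_H)
    then show "edge_side M H \<phi> (toward k) k = fst M - {x \<in> fst M. \<phi> x \<in> below k}"
      unfolding eq[symmetric] by (rule edge_side_complement[OF arc_toward[OF that]])
  qed
  obtain u v where uv: "(u, v) \<in> parcs H"
    "U = edge_side M H \<phi> u v \<or> U = fst M - edge_side M H \<phi> u v"
    using U by (auto simp: displayed_sets_def)
  then consider "u \<in> V" "v = toward u" | "v \<in> V" "u = toward v"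
    by (auto simp: arc_iff)
  then show ?thesis
  proof cases
    case 1
    then show ?thesis
      using uv(2) below(1)[of u] that[of u] by simp
  next
    case 2
    moreover have "fst M - (fst M - {x \<in> fst M. \<phi> x \<in> below v}) = {x \<in> fst M. \<phi> x \<in> below v}"
      by auto
    ultimately have "U = {x \<in> fst M. \<phi> x \<in> below v} \<or> U = fst M - {x \<in> fst M. \<phi> x \<in> below v}"
      using uv(2) below(2)[of v] by auto
    then show ?thesis
      by (rule that[OF 2(1)])
  qed
qed

end

text \<open>In binary: a leading 1 followed by the directions as digits, 0 for left and 1 for right.
  The leading 1 keeps sequences of left turns of different lengths apart. The last direction is the
  lowest digit, so passing to the parent is halving and proofs go by
  \<open>rev_induct\<close>.\<close>

definition heap_number :: "position \<Rightarrow> nat" where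
  "heap_number p = foldl (\<lambda>n d. case d of Lft \<Rightarrow> 2 * n | Rgt \<Rightarrow> 2 * n + 1) 1 p"

lemma heap_number_simps:
  "heap_number [] = 1"
  "heap_number (p @ [Lft]) = 2 * heap_number p"
  "heap_number (p @ [Rgt]) = 2 * heap_number p + 1"
  by (simp_all only: heap_number_def foldl_append foldl.simps direction.case)

lemma heap_number_pos: "0 < heap_number p"
proof (induction p rule: rev_induct)
  case (snoc d p)
  then show ?case
    by (cases d) (simp_all add: heap_number_simps)
qed (simp add: heap_number_simps)

lemma heap_number_snoc_div: "heap_number (p @ [d]) div 2 = heap_number p"
  by (cases d) (simp_all add: heap_number_simps)

lemma heap_number_snoc_ge: "2 \<le> heap_number (p @ [d])"
  using heap_number_snoc_div[of p d] heap_number_pos[of p] by linarith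

lemma inj_heap_number: "inj heap_number"
proof (rule injI)
  show "p = q" if "heap_number p = heap_number q" for p q
    using that
  proof (induction p arbitrary: q rule: rev_induct)
    case Nil
    show ?case
    proof (cases q rule: rev_cases)
      case (snoc q' d)
      then show ?thesis
        using Nil heap_number_snoc_ge[of q' d] by (simp add: heap_number_simps)
    qed simp
  next
    case (snoc c p)
    show ?case
    proof (cases q rule: rev_cases)
      case Nil
      then show ?thesis
        using snoc heap_number_snoc_ge[of p c] by (simp add: heap_number_simps)
    next
      case (snoc q' d)
      have "p = q'"
        using snoc.IH snoc.prems snoc by (metis heap_number_snoc_div)
      moreover have "c = d"
        using snoc.prems snoc \<open>p = q'\<close> by (cases c; cases d) (simp_all add: heap_number_simps)
      ultimately show ?thesis
        using snoc by simp
    qed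
  qed
qed

text \<open>Halving deletes the last direction, so climbing from \<open>q\<close> runs through the
  prefixes of \<open>q\<close>.\<close>

lemma heap_number_below_iff: "heap_number q \<in> below (heap_number p) \<longleftrightarrow> (\<exists>s. q = p @ s)"
proof
  show "\<exists>s. q = p @ s" if "heap_number q \<in> below (heap_number p)"
    using that
  proof (induction q rule: rev_induct)
    case Nil
    then have "heap_number p = heap_number []"
      using below_le[OF Nil] heap_number_pos[of p] by (simp add: heap_number_simps)
    then show ?case
      using injD[OF inj_heap_number] by auto
  next
    case (snoc d q)
    from below_cases[OF snoc.prems] show ?case
    proof
      assume "heap_number (q @ [d]) = heap_number p"
      then have "q @ [d] = p"
        by (rule injD[OF inj_heap_number])
      then show ?thesis
        by auto
    next
      assume "heap_number (q @ [d]) div 2 \<in> below (heap_number p)"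
      then show ?thesis
        using snoc.IH by (auto simp: heap_number_snoc_div)
    qed
  qed
  have "heap_number (p @ s) \<in> below (heap_number p)" for s
  proof (induction s rule: rev_induct)
    case (snoc d s)
    then show ?case
      using heap_number_snoc_div[of "p @ s" d] below_div[of "heap_number (p @ s @ [d])"] by simp
  qed (simp add: below_self)
  then show "heap_number q \<in> below (heap_number p)" if "\<exists>s. q = p @ s"
    using that by auto
qed

section \<open>From the positions of a rooted tree to a heap\<close>

lemma finite_vertices: "finite (vertices T)"
  by (induction T) auto

lemma Nil_in_vertices: "[] \<in> vertices T"
  by (cases T) auto

lemma vertices_snocD: "q @ [d] \<in> vertices T \<Longrightarrow> q \<in> vertices T"
proof (induction T arbitrary: q)
  case (Node l r)
  then show ?case
    by (cases q) (auto simp: Nil_in_vertices)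
qed simp

lemma vertices_sibling: "q @ [Lft] \<in> vertices T \<longleftrightarrow> q @ [Rgt] \<in> vertices T"
proof (induction T arbitrary: q)
  case (Node l r)
  show ?case
  proof (cases q)
    case Nil
    then show ?thesis
      by (simp add: Nil_in_vertices image_iff)
  next
    case (Cons d w)
    then show ?thesis
      using Node.IH[of w] by (cases d) (auto simp: image_iff)
  qed
qed simp

lemma leaves_iff: "q \<in> leaves T \<longleftrightarrow> q \<in> vertices T \<and> q @ [Lft] \<notin> vertices T"
proof (induction T arbitrary: q)
  case (Node l r)
  show ?case
  proof (cases q)
    case Nil
    then show ?thesis
      by (auto simp: Nil_in_vertices)
  next
    case (Cons d w)
    then show ?thesis
      using Node.IH[of w] by (cases d) (auto simp: image_iff)
  qed
qed simp

text \<open>Removing the number 1 suppresses the root. The tree is a \<open>Node\<close>, so 2 and 3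
  are present.\<close>

lemma heap_vertices: "heap (heap_number ` vertices (Node l r) - {1})"
proof -
  let ?T = "Node l r"
  let ?V = "heap_number ` vertices ?T - {1}"
  have mem: "heap_number q \<in> ?V \<longleftrightarrow> q \<in> vertices ?T \<and> q \<noteq> []" for q
    using inj_image_mem_iff[OF inj_heap_number, of q "vertices ?T"]
      inj_eq[OF inj_heap_number, of q "[]"] by (simp add: heap_number_simps del: vertices.simps)
  have snoc: "\<exists>q d. n = heap_number (q @ [d]) \<and> q @ [d] \<in> vertices ?T" if "n \<in> ?V" for n
  proof -
    obtain q where q: "n = heap_number q" "q \<in> vertices ?T"
      using \<open>n \<in> ?V\<close> by blast
    moreover have "n \<noteq> 1"
      using that by blast
    ultimately have "q \<noteq> []"
      using heap_number_simps(1) by metis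
    then show ?thesis
      using q by (metis append_butlast_last_id)
  qed
  show ?thesis
  proof
    show "finite ?V"
      using finite_vertices by blast
    show "2 \<le> n" if "n \<in> ?V" for n
      using snoc[OF that] heap_number_snoc_ge by blast
    show "2 \<in> ?V" "3 \<in> ?V"
      using mem[of "[Lft]"] mem[of "[Rgt]"] heap_number_simps(2)[of "[]"] heap_number_simps(3)[of "[]"]
      by (simp_all add: heap_number_simps Nil_in_vertices)
    show "n div 2 \<in> ?V" if n: "n \<in> ?V" "4 \<le> n" for n
    proof -
      obtain q d where q: "n = heap_number (q @ [d])" "q @ [d] \<in> vertices ?T"
        using snoc[OF n(1)] by blast
      have "q \<noteq> []"
        using n(2) q(1) by (cases d) (auto simp: heap_number_def)
      then show ?thesis
        using q mem vertices_snocD heap_number_snoc_div by metis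
    qed
    show "2 * n \<in> ?V \<longleftrightarrow> 2 * n + 1 \<in> ?V" for n
    proof -
      \<comment> \<open>The lowest binary digit \<open>k\<close> reveals the last direction, and the
        remaining digits reveal the parent.\<close>
      have n: "n = heap_number q \<and> (if k = 0 then d = Lft else d = Rgt)"
        if "2 * n + k = heap_number (q @ [d])" "k < 2" for q d k
        using that by (cases d) (auto simp: heap_number_simps; presburger)+
      have "2 * n + 1 \<in> ?V" if even: "2 * n \<in> ?V"
      proof -
        obtain q d where q: "2 * n = heap_number (q @ [d])" "q @ [d] \<in> vertices ?T"
          using snoc[OF even] by blast
        then have "n = heap_number q" "d = Lft"
          using n[of 0 q d] by auto
        then have "heap_number (q @ [Rgt]) \<in> ?V"
          using q(2) vertices_sibling unfolding mem by blast
        then show ?thesis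
          using \<open>n = heap_number q\<close> by (simp only: heap_number_simps)
      qed
      moreover have "2 * n \<in> ?V" if odd: "2 * n + 1 \<in> ?V"
      proof -
        obtain q d where q: "2 * n + 1 = heap_number (q @ [d])" "q @ [d] \<in> vertices ?T"
          using snoc[OF odd] by blast
        then have "n = heap_number q" "d = Rgt"
          using n[of 1 q d] by auto
        then have "heap_number (q @ [Lft]) \<in> ?V"
          using q(2) vertices_sibling unfolding mem by blast
        then show ?thesis
          using \<open>n = heap_number q\<close> by (simp only: heap_number_simps)
      qed
      ultimately show ?thesis
        by blast
    qed
  qed
qed

text \<open>A single leaf has no root to suppress and is replaced by a one-vertex graph, which
  displays nothing. Otherwise the heap tree is used, and being below a vertex translates into having
  its position as a prefix.\<close>

lemma decomposition_of_rooted_tree: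
  assumes phi: "bij_betw \<phi> (fst M) (leaves T)"
  obtains T' :: "nat pair_pre_digraph" and \<phi>' where "decomposition M T' \<phi>'"
    and "\<And>U. U \<in> displayed_sets M T' \<phi>' \<Longrightarrow> \<exists>p \<in> vertices T.
      U = {x \<in> fst M. \<exists>s. \<phi> x = p @ s} \<or> U = fst M - {x \<in> fst M. \<exists>s. \<phi> x = p @ s}"
proof (cases T)
  case Leaf
  let ?T' = "\<lparr>pverts = {0 :: nat}, parcs = {}\<rparr>" and ?\<phi>' = "\<lambda>x. 0 :: nat"
  have graph: "pair_graph ?T'"
    by (rule pair_graphI) (auto simp: sym_def)
  have "length p \<le> 1" if "vpath p (with_proj ?T')" for p
  proof -
    have "distinct p" "set p \<subseteq> {0}"
      using that by (auto simp: vpath_def vwalk_def)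
    then show ?thesis
      using card_mono[of "{0 :: nat}" "set p"] by (simp add: distinct_card)
  qed
  then have "undirected_tree ?T'"
    using graph by (auto simp: undirected_tree_def connected_iff_rtrancl)
  then have "subcubic_tree ?T'"
    by (simp add: subcubic_tree_def)
  moreover have "subcubic_leaves ?T' = {0}"
    by (auto simp: subcubic_leaves_def)
  moreover have "card (fst M) = 1"
    using bij_betw_same_card[OF phi] Leaf by simp
  then have "bij_betw ?\<phi>' (fst M) {0}"
    by (auto simp: card_1_singleton_iff bij_betw_def)
  ultimately have "decomposition M ?T' ?\<phi>'"
    by (simp add: decomposition_def)
  then show ?thesis
    by (rule that) (simp add: displayed_sets_def)
next
  case (Node l r)
  define V where "V = heap_number ` vertices T - {1}"
  interpret heap V
    unfolding V_def Node by (rule heap_vertices)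
  have mem: "heap_number q \<in> V \<longleftrightarrow> q \<in> vertices T \<and> q \<noteq> []" for q
    using inj_image_mem_iff[OF inj_heap_number, of q "vertices T"]
      inj_eq[OF inj_heap_number, of q "[]"] by (simp add: heap_number_simps V_def)
  let ?\<phi>' = "\<lambda>x. heap_number (\<phi> x)"
  have leaf: "heap_number q \<in> subcubic_leaves H \<longleftrightarrow> q \<in> leaves T" for q
  proof -
    have "[] \<notin> leaves T"
      by (auto simp: Node)
    then show ?thesis
      unfolding subcubic_leaves_H leaves_iff mem heap_number_simps(2)[symmetric] mem_Collect_eq
      by (metis leaves_iff append_is_Nil_conv list.discI)
  qed
  have "subcubic_leaves H = heap_number ` leaves T"
  proof
    show "subcubic_leaves H \<subseteq> heap_number ` leaves T"
    proof
      fix n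
      assume n: "n \<in> subcubic_leaves H"
      then have "n \<in> V"
        by (simp add: subcubic_leaves_H)
      then obtain q where "n = heap_number q"
        unfolding V_def by blast
      with n leaf show "n \<in> heap_number ` leaves T"
        by blast
    qed
  qed (use leaf in blast)
  moreover have "bij_betw heap_number (leaves T) (heap_number ` leaves T)"
    using inj_heap_number by (simp add: bij_betw_def inj_on_def)
  then have "bij_betw ?\<phi>' (fst M) (heap_number ` leaves T)"
    using bij_betw_trans[OF phi] by (simp add: comp_def)
  ultimately have bij: "bij_betw ?\<phi>' (fst M) (subcubic_leaves H)"
    by simp
  then have dec: "decomposition M H ?\<phi>'"
    using subcubic_tree_H by (simp add: decomposition_def)
  have "subcubic_leaves H \<subseteq> V"
    by (auto simp: subcubic_leaves_H)
  then have sub: "?\<phi>' ` fst M \<subseteq> V"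
    using bij_betw_imp_surj_on[OF bij] by simp
  show ?thesis
  proof (rule that[OF dec])
    fix U
    assume "U \<in> displayed_sets M H ?\<phi>'"
    then obtain k where k: "k \<in> V"
      "U = {x \<in> fst M. ?\<phi>' x \<in> below k} \<or> U = fst M - {x \<in> fst M. ?\<phi>' x \<in> below k}"
      by (rule displayed_sets_H[OF sub])
    then obtain p where "p \<in> vertices T" "k = heap_number p"
      by (auto simp: V_def)
    then show "\<exists>p \<in> vertices T. U = {x \<in> fst M. \<exists>s. \<phi> x = p @ s} \<or>
        U = fst M - {x \<in> fst M. \<exists>s. \<phi> x = p @ s}"
      using k(2) by (intro bexI[of _ p]) (simp_all add: heap_number_below_iff)
  qed
qed

section \<open>From an automaton to bounded decomposition-width\<close>

lemma run_states: "tree_automaton A \<Longrightarrow> run A T \<sigma> p \<subseteq> states A"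
proof (induction T arbitrary: \<sigma> p)
  case Leaf
  then show ?case
    by (auto simp: leaf_step_def tree_automaton_def ran_def split: option.splits)
next
  case (Node l r)
  have delta2: "the (delta2 A x) \<subseteq> states A" if defined: "delta2 A x \<noteq> None" for x
  proof -
    obtain R where R: "delta2 A x = Some R"
      using defined by blast
    then have "R \<in> ran (delta2 A)"
      by (rule ranI)
    moreover have "ran (delta2 A) \<subseteq> Pow (states A)"
      using Node.prems by (simp add: tree_automaton_def)
    ultimately show ?thesis
      using R by auto
  qed
  have "node_step A s RL RR \<subseteq> states A" for s RL RR
  proof (cases "\<forall>(qL, qR) \<in> RL \<times> RR. delta2 A (s, qL, qR) \<noteq> None")
    case True
    show ?thesis
      unfolding node_step_def if_P[OF True]
    proof (rule UN_least)
      fix q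
      assume "q \<in> RL \<times> RR"
      with True have "delta2 A (s, fst q, snd q) \<noteq> None"
        by (metis (mono_tags, lifting) case_prodE prod.sel)
      then show "(case q of (qL, qR) \<Rightarrow> the (delta2 A (s, qL, qR))) \<subseteq> states A"
        unfolding case_prod_beta by (rule delta2)
    qed
  next
    case False
    show ?thesis
      unfolding node_step_def if_not_P[OF False] by simp
  qed
  with Node show ?case
    by (auto split: list.split direction.split)
qed

lemma run_cong_below:
  "p \<in> vertices T \<Longrightarrow> (\<And>s. \<sigma> (p @ s) = \<sigma>' (p @ s)) \<Longrightarrow> run A T \<sigma> p = run A T \<sigma>' p"
proof (induction T arbitrary: \<sigma> \<sigma>' p)
  case (Node l r)
  show ?case
  proof (cases p)
    case Nil
    then have "\<sigma> = \<sigma>'"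
      using Node.prems(2) by auto
    then show ?thesis
      by simp
  next
    case (Cons d w)
    show ?thesis
    proof (cases d)
      case Lft
      then show ?thesis
        using Node.prems Node.IH(1)[of w "\<lambda>w. \<sigma> (Lft # w)" "\<lambda>w. \<sigma>' (Lft # w)"] Cons by auto
    next
      case Rgt
      then show ?thesis
        using Node.prems Node.IH(2)[of w "\<lambda>w. \<sigma> (Rgt # w)" "\<lambda>w. \<sigma>' (Rgt # w)"] Cons by auto
    qed
  qed
qed (metis append_Nil2 empty_iff insert_iff run.simps(1) vertices.simps(1))

text \<open>The labels below \<open>p\<close> influence the root only through the value at
  \<open>p\<close>. This bottleneck is what limits the number of classes.\<close>

lemma run_root_cong:
  "p \<in> vertices T \<Longrightarrow> run A T \<sigma> p = run A T \<sigma>' p \<Longrightarrow>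
    (\<And>q. \<nexists>s. q = p @ s \<Longrightarrow> \<sigma> q = \<sigma>' q) \<Longrightarrow> run A T \<sigma> [] = run A T \<sigma>' []"
proof (induction T arbitrary: \<sigma> \<sigma>' p)
  case (Node l r)
  show ?case
  proof (cases p)
    case Nil
    then show ?thesis
      using Node.prems(2) by simp
  next
    case (Cons d w)
    have root: "\<sigma> [] = \<sigma>' []"
      using Node.prems(3) Cons by simp
    show ?thesis
    proof (cases d)
      case Lft
      have "(\<lambda>w. \<sigma> (Rgt # w)) = (\<lambda>w. \<sigma>' (Rgt # w))"
        using Node.prems(3) Cons Lft by auto
      moreover have "run A l (\<lambda>w. \<sigma> (Lft # w)) [] = run A l (\<lambda>w. \<sigma>' (Lft # w)) []"
        using Node.prems Cons Lft by (intro Node.IH(1)[of w]) auto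
      ultimately show ?thesis
        using root by simp
    next
      case Rgt
      have "(\<lambda>w. \<sigma> (Lft # w)) = (\<lambda>w. \<sigma>' (Lft # w))"
        using Node.prems(3) Cons Rgt by auto
      moreover have "run A r (\<lambda>w. \<sigma> (Rgt # w)) [] = run A r (\<lambda>w. \<sigma>' (Rgt # w)) []"
        using Node.prems Cons Rgt by (intro Node.IH(2)[of w]) auto
      ultimately show ?thesis
        using root by simp
    qed
  qed
qed auto

section \<open>Counting equivalence classes\<close>

lemma card_quotient_le:
  assumes "equiv A R" "finite B" "g ` A \<subseteq> B"
    and g: "\<And>x y. x \<in> A \<Longrightarrow> y \<in> A \<Longrightarrow> g x = g y \<Longrightarrow> (x, y) \<in> R"
  shows "card (A // R) \<le> card B"
proof -
  \<comment> \<open>\<open>inv_into\<close> chooses one representative for each value of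
    \<open>g\<close>, so a class can be recovered from the value alone.\<close>
  have "R `` {x} = R `` {inv_into A g (g x)}" if "x \<in> A" for x
    using that inv_into_into[of "g x" g A] f_inv_into_f[of "g x" g A]
    by (intro equiv_class_eq[OF assms(1)] g) auto
  then have "A // R \<subseteq> (\<lambda>b. R `` {inv_into A g b}) ` B"
    using assms(3) by (force simp: quotient_def)
  then show ?thesis
    using assms(2) by (rule surj_card_le[rotated])
qed

lemma card_classes_complement:
  assumes M: "set_system M" and U: "U \<subseteq> fst M"
  shows "card (Pow (fst M - U) // set_equiv M (fst M - U)) \<le> 2 ^ card (Pow U // set_equiv M U)"
proof -
  let ?Q = "Pow U // set_equiv M U"
  \<comment> \<open>Asking for one \<open>Z\<close> in the class \<open>c\<close> is the same as
    asking for all of them: equivalent sets are interchangeable against any \<open>X\<close> outside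
    \<open>U\<close>.\<close>
  define g where "g = (\<lambda>X. {c \<in> ?Q. \<exists>Z \<in> c. X \<union> Z \<in> snd M})"
  have "finite U"
    using M U finite_subset by (auto simp: set_system_def)
  then have fin: "finite ?Q"
    by (intro finite_quotient) (auto simp: set_equiv_def)
  have imp: "X' \<union> Z \<in> snd M"
    if "g X = g X'" "X' \<subseteq> fst M - U" "Z \<subseteq> U" "X \<union> Z \<in> snd M" for X X' Z
  proof -
    have Z: "(Z, Z) \<in> set_equiv M U"
      using that(3) by (simp add: set_equiv_def)
    then have "set_equiv M U `` {Z} \<in> g X"
      using that(3,4) by (auto simp: g_def quotientI)
    then have "set_equiv M U `` {Z} \<in> g X'"
      by (simp only: that(1))
    then obtain Z' where Z': "(Z, Z') \<in> set_equiv M U" "X' \<union> Z' \<in> snd M"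
      by (auto simp: g_def)
    then show ?thesis
      using set_equivD[OF Z'(1) that(2)] by (simp add: Un_commute)
  qed
  have "card (Pow (fst M - U) // set_equiv M (fst M - U)) \<le> card (Pow ?Q)"
  proof (rule card_quotient_le[OF equiv_set_equiv])
    fix X X'
    assume X: "X \<in> Pow (fst M - U)" "X' \<in> Pow (fst M - U)" "g X = g X'"
    have "X \<union> Z \<in> snd M \<longleftrightarrow> X' \<union> Z \<in> snd M" if "Z \<subseteq> fst M - (fst M - U)" for Z
    proof -
      have "Z \<subseteq> U"
        using that by blast
      then show ?thesis
        using imp[of X X' Z] imp[of X' X Z] X by auto
    qed
    then show "(X, X') \<in> set_equiv M (fst M - U)"
      using X by (simp add: set_equiv_def)
  qed (use fin in \<open>auto simp: g_def\<close>)
  also have "\<dots> = 2 ^ card ?Q"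
    using fin by (rule card_Pow)
  finally show ?thesis .
qed

text \<open>Labels below \<open>p\<close> see only the part of a set inside \<open>U\<close>, and
  all other labels only the part outside. Hence equal run values at \<open>p\<close> stay equal
  after adding \<open>Z\<close>, and they propagate to equal values at the root.\<close>

lemma card_classes_below:
  fixes i \<sigma>
  assumes A: "tree_automaton A" and phi: "bij_betw \<phi> E (leaves T)" and p: "p \<in> vertices T"
  defines "M \<equiv> encoded_set_system i A E T \<sigma> \<phi>" and "U \<equiv> {x \<in> E. \<exists>s. \<phi> x = p @ s}"
  shows "card (Pow U // set_equiv M U) \<le> 2 ^ card (states A)"
proof -
  have inv: "inv_into E \<phi> q \<in> E" "\<phi> (inv_into E \<phi> q) = q" if "q \<in> leaves T" for q
    using that bij_betw_imp_surj_on[OF phi] by (auto simp: inv_into_into f_inv_into_f)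
  have inside: "enc i E T \<sigma> \<phi> (X \<union> Z) (p @ s) = enc i E T \<sigma> \<phi> X (p @ s)"
    if "Z \<inter> U = {}" for X Z s
    using that inv[of "p @ s"] unfolding enc_def U_def by fastforce
  have outside: "enc i E T \<sigma> \<phi> (X \<union> Z) q = enc i E T \<sigma> \<phi> (X' \<union> Z) q"
    if "X \<subseteq> U" "X' \<subseteq> U" "\<nexists>s. q = p @ s" for X X' Z q
  proof (cases "q \<in> leaves T")
    case True
    then have "inv_into E \<phi> q \<notin> U"
      using inv(2) that(3) by (auto simp: U_def)
    then have "inv_into E \<phi> q \<in> X \<union> Z \<longleftrightarrow> inv_into E \<phi> q \<in> X' \<union> Z"
      using that(1,2) by blast
    then show ?thesis
      by (simp add: enc_def)
  qed (simp add: enc_def)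
  have "card (Pow U // set_equiv M U) \<le> card (Pow (states A))"
  proof (rule card_quotient_le[OF equiv_set_equiv, where g = "\<lambda>X. run A T (enc i E T \<sigma> \<phi> X) p"])
    fix X X'
    assume X: "X \<in> Pow U" "X' \<in> Pow U"
      and eq: "run A T (enc i E T \<sigma> \<phi> X) p = run A T (enc i E T \<sigma> \<phi> X') p"
    have "X \<union> Z \<in> snd M \<longleftrightarrow> X' \<union> Z \<in> snd M" if Z: "Z \<subseteq> fst M - U" for Z
    proof -
      have "Z \<inter> U = {}"
        using Z by blast
      then have "run A T (enc i E T \<sigma> \<phi> (Y \<union> Z)) p = run A T (enc i E T \<sigma> \<phi> Y) p" for Y
        by (intro run_cong_below p inside)
      then have "run A T (enc i E T \<sigma> \<phi> (X \<union> Z)) p = run A T (enc i E T \<sigma> \<phi> (X' \<union> Z)) p"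
        by (simp only: eq)
      then have "run A T (enc i E T \<sigma> \<phi> (X \<union> Z)) [] = run A T (enc i E T \<sigma> \<phi> (X' \<union> Z)) []"
        using X by (intro run_root_cong[OF p] outside) auto
      moreover have "X \<union> Z \<subseteq> E" "X' \<union> Z \<subseteq> E"
        using X Z by (auto simp: U_def M_def encoded_set_system_def)
      ultimately show ?thesis
        by (simp add: M_def encoded_set_system_def accepts_def)
    qed
    then show "(X, X') \<in> set_equiv M U"
      using X by (simp add: set_equiv_def)
  qed (use A run_states[OF A] in \<open>auto simp: tree_automaton_def\<close>)
  also have "\<dots> = 2 ^ card (states A)"
    using A by (intro card_Pow) (simp add: tree_automaton_def)
  finally show ?thesis .
qed

lemma decomposition_width_le:
  fixes T :: "nat pair_pre_digraph"
  shows "decomposition M T \<phi> \<Longrightarrow> decomposition_width M \<le> decomposition_dw M T \<phi>"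
  unfolding decomposition_width_def by (rule Least_le) blast

lemma encoded_decomposition_width_le:
  assumes A: "tree_automaton A" and M: "set_system M"
    and phi: "bij_betw \<phi> (fst M) (leaves T)" and eq: "M = encoded_set_system i A (fst M) T \<sigma> \<phi>"
  shows "decomposition_width M \<le> 2 ^ 2 ^ card (states A)"
proof -
  obtain T' :: "nat pair_pre_digraph" and \<phi>' where dec: "decomposition M T' \<phi>'"
    and displayed: "\<And>U. U \<in> displayed_sets M T' \<phi>' \<Longrightarrow> \<exists>p \<in> vertices T.
      U = {x \<in> fst M. \<exists>s. \<phi> x = p @ s} \<or> U = fst M - {x \<in> fst M. \<exists>s. \<phi> x = p @ s}"
    by (rule decomposition_of_rooted_tree[OF phi]) (rule that)
  have "card (Pow U // set_equiv M U) \<le> 2 ^ 2 ^ card (states A)"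
    if U: "U \<in> displayed_sets M T' \<phi>'" for U
  proof -
    obtain p where p: "p \<in> vertices T"
      "U = {x \<in> fst M. \<exists>s. \<phi> x = p @ s} \<or> U = fst M - {x \<in> fst M. \<exists>s. \<phi> x = p @ s}"
      using displayed[OF U] by blast
    let ?W = "{x \<in> fst M. \<exists>s. \<phi> x = p @ s}"
    have W: "card (Pow ?W // set_equiv M ?W) \<le> 2 ^ card (states A)"
      using card_classes_below[OF A phi p(1), where i = i and \<sigma> = \<sigma>] by (simp only: eq[symmetric])
    from p(2) show ?thesis
    proof
      assume "U = ?W"
      then have "card (Pow U // set_equiv M U) \<le> 2 ^ card (states A)"
        using W by (simp only:)
      also have "\<dots> \<le> 2 ^ 2 ^ card (states A)"
        \<comment> \<open>The side below \<open>p\<close> satisfies the smaller bound;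
          \<open>n < 2 ^ n\<close> puts both sides under a common one.\<close>
        by (intro power_increasing less_imp_le less_exp) simp
      finally show ?thesis .
    next
      assume "U = fst M - ?W"
      then have "card (Pow U // set_equiv M U) \<le> 2 ^ card (Pow ?W // set_equiv M ?W)"
        using card_classes_complement[OF M, of ?W] by auto
      also have "\<dots> \<le> 2 ^ 2 ^ card (states A)"
        using W by (intro power_increasing) auto
      finally show ?thesis .
    qed
  qed
  moreover have "pair_graph T'"
    using dec by (simp add: decomposition_def subcubic_tree_def undirected_tree_def)
  then have "finite (displayed_sets M T' \<phi>')"
    by (rule finite_displayed_sets)
  ultimately have "decomposition_dw M T' \<phi>' \<le> 2 ^ 2 ^ card (states A)"
    unfolding decomposition_dw_def by (subst Max_le_iff) auto
  then show ?thesis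
    using decomposition_width_le[OF dec] by linarith
qed

text \<open>A caterpillar: each new element becomes a leaf next to the whole tree built so
  far.\<close>

lemma ex_rooted_tree_leaves:
  assumes "finite E" "E \<noteq> {}"
  shows "\<exists>T \<phi>. bij_betw \<phi> E (leaves T)"
  using assms
proof (induction rule: finite_ne_induct)
  case (singleton x)
  have "bij_betw (\<lambda>_. []) {x} (leaves Leaf)"
    by (simp add: bij_betw_def)
  then show ?case
    by blast
next
  case (insert x F)
  then obtain T \<phi> where T: "bij_betw \<phi> F (leaves T)"
    by blast
  have "bij_betw (\<lambda>_. []) {x} (leaves Leaf)"
    by (simp add: bij_betw_def)
  from enc_Node(1)[OF this T] insert.hyps show ?case
    by (metis Int_insert_left_if0 inf_bot_left insert_is_Un)
qed

text \<open>The \<open>LEAST\<close> in \<open>decomposition_width\<close> is attained only if some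
  decomposition exists; the caterpillar supplies one.\<close>

lemma ex_decomposition_of_width:
  assumes "set_system M"
  obtains T :: "nat pair_pre_digraph" and \<phi>
  where "decomposition M T \<phi>" "decomposition_width M = decomposition_dw M T \<phi>"
proof -
  obtain R \<rho> where rho: "bij_betw \<rho> (fst M) (leaves R)"
    using ex_rooted_tree_leaves[of "fst M"] assms by (auto simp: set_system_def)
  obtain T0 :: "nat pair_pre_digraph" and \<phi>0 where "decomposition M T0 \<phi>0"
    by (rule decomposition_of_rooted_tree[OF rho]) (rule that)
  then have "\<exists>k (T :: nat pair_pre_digraph) \<phi>. decomposition M T \<phi> \<and> k = decomposition_dw M T \<phi>"
    by blast
  then have "\<exists>(T :: nat pair_pre_digraph) \<phi>. decomposition M T \<phi> \<and>
      decomposition_width M = decomposition_dw M T \<phi>"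
    unfolding decomposition_width_def by (rule LeastI_ex)
  then show ?thesis
    using that by blast
qed

theorem theorem1p4:
  fixes \<M> :: "'a set_system set"
  assumes "\<And>M. M \<in> \<M> \<Longrightarrow> set_system M"
  shows "automatic \<M> \<longleftrightarrow> bounded_decomposition_width \<M>"
proof
  assume "automatic \<M>"
  then obtain i \<Sigma> and A :: "(nat enc_letter, nat) automaton" where A: "ary_automaton i \<Sigma> A"
    and enc: "\<And>M. M \<in> \<M> \<Longrightarrow> \<exists>T \<sigma> \<phi>. sigma_tree \<Sigma> T \<sigma> \<and> bij_betw \<phi> (fst M) (leaves T) \<and>
      M = encoded_set_system i A (fst M) T \<sigma> \<phi>"
    unfolding automatic_def by blast
  have "tree_automaton A"
    using A by (simp add: ary_automaton_def)
  then have "decomposition_width M \<le> 2 ^ 2 ^ card (states A)" if "M \<in> \<M>" for M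
    using enc[OF that] encoded_decomposition_width_le assms[OF that] by blast
  then show "bounded_decomposition_width \<M>"
    unfolding bounded_decomposition_width_def by blast
next
  assume "bounded_decomposition_width \<M>"
  then obtain K0 where K0: "\<And>M. M \<in> \<M> \<Longrightarrow> decomposition_width M \<le> K0"
    unfolding bounded_decomposition_width_def by blast
  \<comment> \<open>At least two states are required: a leaf reads its presence bit as a table
    index, and the root must tell members from non-members.\<close>
  define K where "K = max 2 K0"
  \<comment> \<open>Letters must be natural numbers, so an initial segment serves as names for the
    tables. There are finitely many, since tables are extensional outside their index
    square.\<close>
  define \<Sigma> where "\<Sigma> = {0..<card (tables K)}"
  have "finite (tables K)"
    unfolding tables_def by (intro finite_PiE) auto
  then obtain h where "bij_betw h \<Sigma> (tables K)"
    unfolding \<Sigma>_def using ex_bij_betw_nat_finite by blast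
  then have h: "h ` \<Sigma> = tables K"
    by (rule bij_betw_imp_surj_on)
  have K: "2 \<le> K" "K0 \<le> K"
    by (simp_all add: K_def)
  have "\<exists>T \<sigma> \<phi>. sigma_tree \<Sigma> T \<sigma> \<and> bij_betw \<phi> (fst M) (leaves T) \<and>
      M = encoded_set_system 1 (table_automaton K \<Sigma> h) (fst M) T \<sigma> \<phi>" if M: "M \<in> \<M>" for M
  proof -
    obtain T :: "nat pair_pre_digraph" and \<phi> where
      T: "decomposition M T \<phi>" "decomposition_width M = decomposition_dw M T \<phi>"
      by (rule ex_decomposition_of_width[OF assms[OF M]]) (rule that)
    then have "decomposition_dw M T \<phi> \<le> K"
      using K0[OF M] K(2) by simp
    then show ?thesis
      by (rule encoded_by_table_automaton[OF assms[OF M] T(1) _ K(1) h])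
  qed
  moreover have "ary_automaton 1 \<Sigma> (table_automaton K \<Sigma> h)"
    using h K(1) by (intro ary_table_automaton) (auto simp: \<Sigma>_def)
  ultimately show "automatic \<M>"
    unfolding automatic_def by (intro exI[of _ 1] exI[of _ \<Sigma>] exI[of _ "table_automaton K \<Sigma> h"]) auto
qed

end
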